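(* Let ${\mathscr X}$ be a Hausdorff space and ${\mathscr A}$ a set of finite Borel partitions of ${\mathscr X}$, directed under refinement, which resolves ${\mathscr X}$. Equip $M^1({\mathscr X})$ with the weak topology and assume the minimal conditions hold. Let $(\Pi_\alpha)_{\alpha\in{\mathscr A}}$ be a coherent system of Borel probability measures on the simplices $M^1({\mathscr X}_\alpha)$. Then there exists a unique Radon probability measure $\Pi$ on $M^1({\mathscr X})$ (weak topology) projecting to $\Pi_\alpha$ for every $\alpha\in{\mathscr A}$ if and only if there is a $Q\in M^1({\mathscr X})$ such that for every $\epsilon,\delta>0$ there is an $L>0$ with $$\Pi_\alpha\bigl(\{P_\alpha\in M^1({\mathscr X}_\alpha):\|P_\alpha-P_\alpha\wedge LQ_\alpha\|_{1,\alpha}>\delta\}\bigr)<\epsilon\quad\text{for all }\alpha\in{\mathscr A}.$$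
   Context: Partition: finite collection of non-empty disjoint Borel sets covering ${\mathscr X}$; $\alpha\le\beta$ iff $\beta$ refines $\alpha$; ${\mathscr A}$ resolves ${\mathscr X}$ if the sets in its partitions generate the Borel $\sigma$-algebra. $M^1({\mathscr X})$: Radon probability measures on ${\mathscr X}$; weak topology: coarsest making $P\mapsto\int h\,dP$ continuous for all bounded Borel $h$. Minimal conditions: ${\mathscr X}$ and $M^1({\mathscr X})$ are Hausdorff, ${\mathscr A}$ is a directed set of finite Borel partitions, and $P\mapsto P(A)$ is Borel measurable on $M^1({\mathscr X})$ for every $A\in\alpha\in{\mathscr A}$. For $\alpha\in{\mathscr A}$, $M^1({\mathscr X}_\alpha)$ is the simplex of probability vectors $(p_A)_{A\in\alpha}$; the projection is $P\mapsto P_\alpha=(P(A))_{A\in\alpha}$; for $\alpha\le\beta$ the transition map $\varphi_{\alpha\beta}:M^1({\mathscr X}_\beta)\to M^1({\mathscr X}_\alpha)$ is $(\varphi_{\alpha\beta}p)_A=\sum_{B\in\beta,B\subset A}p_B$. The system is coherent if $\Pi_\alpha=\Pi_\beta\circ\varphi_{\alpha\beta}^{-1}$ whenever $\alpha\le\beta$. $\Pi$ projects to $\Pi_\alpha$ if $\Pi_\alpha$ is the law of $P_\alpha$ under $P\sim\Pi$. $P_\alpha\wedge LQ_\alpha$ is the componentwise minimum and $\|\cdot\|_{1,\alpha}$ the $\ell^1$-norm over $A\in\alpha$. *)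

theory Defs
  imports "HOL-Analysis.Analysis" "HOL-Probability.Probability"
begin

definition borel_of :: "'a topology \<Rightarrow> 'a measure" where
  "borel_of T = sigma (topspace T) {U. openin T U}"

definition radon_prob :: "'a topology \<Rightarrow> 'a measure \<Rightarrow> bool" where
  "radon_prob T M \<longleftrightarrow>
     sets M = sets (borel_of T) \<and> prob_space M \<and>
     (\<forall>B\<in>sets M. emeasure M B = (SUP K\<in>{K. compactin T K \<and> K \<subseteq> B}. emeasure M K))"

definition M1 :: "'a topology \<Rightarrow> 'a measure set" where
  "M1 X = {P. radon_prob X P}"

definition weak_top :: "'a topology \<Rightarrow> 'a measure topology" where
  "weak_top X = topology_generated_by
     {{P \<in> M1 X. (\<integral>x. h x \<partial>P) \<in> U} | (h :: 'a \<Rightarrow> real) U.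
        h \<in> borel_measurable (borel_of X) \<and> bounded (h ` topspace X) \<and> open U}"

definition borel_partition :: "'a topology \<Rightarrow> 'a set set \<Rightarrow> bool" where
  "borel_partition X \<alpha> \<longleftrightarrow> finite \<alpha> \<and> (\<forall>A\<in>\<alpha>. A \<noteq> {} \<and> A \<in> sets (borel_of X)) \<and>
     disjoint \<alpha> \<and> \<Union>\<alpha> = topspace X"

text \<open>refines \<alpha> \<beta>: \<beta> refines \<alpha> (i.e. \<alpha> \<le> \<beta>).\<close>
definition refines :: "'a set set \<Rightarrow> 'a set set \<Rightarrow> bool" where
  "refines \<alpha> \<beta> \<longleftrightarrow> (\<forall>B\<in>\<beta>. \<exists>A\<in>\<alpha>. B \<subseteq> A)"

definition directed_partitions :: "'a set set set \<Rightarrow> bool" where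
  "directed_partitions \<A> \<longleftrightarrow> (\<forall>\<alpha>\<in>\<A>. \<forall>\<beta>\<in>\<A>. \<exists>\<gamma>\<in>\<A>. refines \<alpha> \<gamma> \<and> refines \<beta> \<gamma>)"

definition resolves :: "'a topology \<Rightarrow> 'a set set set \<Rightarrow> bool" where
  "resolves X \<A> \<longleftrightarrow> sigma_sets (topspace X) (\<Union>\<A>) = sets (borel_of X)"

definition prob_simplex :: "'a set set \<Rightarrow> ('a set \<Rightarrow> real) set" where
  "prob_simplex \<alpha> = {p. p \<in> (\<alpha> \<rightarrow>\<^sub>E (UNIV::real set)) \<and> (\<forall>A\<in>\<alpha>. 0 \<le> p A) \<and> (\<Sum>A\<in>\<alpha>. p A) = 1}"

definition prob_simplex_top :: "'a set set \<Rightarrow> ('a set \<Rightarrow> real) topology" where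
  "prob_simplex_top \<alpha> = subtopology (powertop_real \<alpha>) (prob_simplex \<alpha>)"

definition proj :: "'a set set \<Rightarrow> 'a measure \<Rightarrow> ('a set \<Rightarrow> real)" where
  "proj \<alpha> P = (\<lambda>A\<in>\<alpha>. measure P A)"

definition trans_map :: "'a set set \<Rightarrow> 'a set set \<Rightarrow> ('a set \<Rightarrow> real) \<Rightarrow> ('a set \<Rightarrow> real)" where
  "trans_map \<alpha> \<beta> p = (\<lambda>A\<in>\<alpha>. \<Sum>B\<in>{B\<in>\<beta>. B \<subseteq> A}. p B)"

definition coherent ::
  "'a set set set \<Rightarrow> ('a set set \<Rightarrow> ('a set \<Rightarrow> real) measure) \<Rightarrow> bool" where
  "coherent \<A> Pim \<longleftrightarrow> (\<forall>\<alpha>\<in>\<A>. \<forall>\<beta>\<in>\<A>. refines \<alpha> \<beta> \<longrightarrow>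
      Pim \<alpha> = distr (Pim \<beta>) (borel_of (prob_simplex_top \<alpha>)) (trans_map \<alpha> \<beta>))"

definition projects_to :: "'a measure measure \<Rightarrow> 'a set set \<Rightarrow> ('a set \<Rightarrow> real) measure \<Rightarrow> bool" where
  "projects_to Pim \<alpha> Pia \<longleftrightarrow> Pia = distr Pim (borel_of (prob_simplex_top \<alpha>)) (proj \<alpha>)"

definition minimal_conditions :: "'a topology \<Rightarrow> 'a set set set \<Rightarrow> bool" where
  "minimal_conditions X \<A> \<longleftrightarrow> Hausdorff_space X \<and> Hausdorff_space (weak_top X) \<and>
     directed_partitions \<A> \<and> (\<forall>\<alpha>\<in>\<A>. borel_partition X \<alpha>) \<and>
     (\<forall>\<alpha>\<in>\<A>. \<forall>A\<in>\<alpha>. (\<lambda>P. measure P A) \<in> borel_measurable (borel_of (weak_top X)))"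

end

theory Submission
  imports Defs
begin

text \<open>
  Necessity: on a compact \<open>K \<subseteq> M\<^sup>1(X)\<close> evaluation at a Borel set is continuous, so by Dini
  the measures in \<open>K\<close> are uniformly continuous from above; this yields finite subsets of \<open>K\<close>
  that uniformly dominate it.  A countable mixture \<open>Q\<close> of such subsets, over a sequence of compacts
  exhausting the Radon measure, satisfies the condition.

  Sufficiency: for \<open>d\<^sub>k \<rightarrow> 0\<close> the set of all \<open>P\<close> with \<open>P B \<le> L\<^sub>k Q B + d\<^sub>k\<close> for all \<open>k\<close>
  and \<open>B\<close> is compact (Tychonoff), and spreading a probability vector over the cells proportionally to
  \<open>Q\<close> shows that it projects onto all vectors obeying the same bounds.  Hence the finitely additive
  measure on cylinder sets given by the coherent system is tight, and it extends to a Radon measure by an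
  outer measure construction of Riesz type.  Uniqueness holds without the condition, since disjoint
  compact sets are separated by open cylinders.
\<close>

section \<open>Radon probability measures and separating families\<close>

text \<open>The weak topology here tests against all bounded Borel functions, so evaluation at any
  Borel set is continuous. This makes compactness restrictive: the members of a compact set are
  uniformly absolutely continuous with respect to one measure, which is why tightness turns into
  domination by \<open>Q\<close>. Conversely, a bound with a single pair \<open>L\<close>,
  \<open>d\<close> does not give compactness in general: a limit of measures on the cube is only
  finitely additive, and bounds with \<open>d k\<close> tending to 0 restore countable additivity.
  On the extension side, \<open>\<A>\<close> may be uncountable and the open cylinders need not form
  a base of the weak topology, so open sets cannot be approximated by cylinders. The construction
  starts from compact sets, uses cylinders only to separate them, and at first yields
  \<open>measure M U \<le> m U\<close>; equality is recovered on the simplices, where open sets are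
  countable unions of closed sets.\<close>

lemma space_borel_of [simp]: "space (borel_of T) = topspace T"
  unfolding borel_of_def by (rule space_measure_of) (auto dest: openin_subset)

lemma sets_borel_of: "sets (borel_of T) = sigma_sets (topspace T) {U. openin T U}"
  unfolding borel_of_def by (rule sets_measure_of) (auto dest: openin_subset)

lemma borel_of_openin: "openin T U \<Longrightarrow> U \<in> sets (borel_of T)"
  by (auto simp: sets_borel_of)

lemma borel_of_closedin: "closedin T F \<Longrightarrow> F \<in> sets (borel_of T)"
  using sets.compl_sets[OF borel_of_openin[of T "topspace T - F"]]
  by (simp add: closedin_def double_diff)

lemma radon_probD:
  assumes "radon_prob T M"
  shows "sets M = sets (borel_of T)" "prob_space M" "space M = topspace T"
  using assms sets_eq_imp_space_eq[of M "borel_of T"] by (auto simp: radon_prob_def)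

lemma radon_prob_inner:
  assumes T: "Hausdorff_space T" and M: "radon_prob T M" and B: "B \<in> sets M" and e: "e > 0"
  obtains K where "compactin T K" "K \<subseteq> B" "K \<in> sets M" "measure M B < measure M K + e"
proof -
  interpret prob_space M using M by (simp add: radon_prob_def)
  have "emeasure M B < emeasure M B + e"
    using e by (simp add: emeasure_eq_measure ennreal_less_iff flip: ennreal_plus)
  have "\<exists>K. compactin T K \<and> K \<subseteq> B \<and> emeasure M B < emeasure M K + e"
  proof (rule ccontr)
    assume "\<not> ?thesis"
    then have *: "emeasure M K + e \<le> emeasure M B" if "compactin T K" "K \<subseteq> B" for K
      using that by (meson not_less)
    have "emeasure M K \<le> ennreal (measure M B - e)" if "compactin T K" "K \<subseteq> B" for K
      using *[OF that] e
      by (auto simp: emeasure_eq_measure intro!: ennreal_leI simp flip: ennreal_plus)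
    then have "(SUP K\<in>{K. compactin T K \<and> K \<subseteq> B}. emeasure M K) \<le> ennreal (measure M B - e)"
      by (intro SUP_least) auto
    then have "emeasure M B \<le> ennreal (measure M B - e)"
      using M B unfolding radon_prob_def by metis
    \<comment> \<open>The case \<open>K = {}\<close>. It keeps \<open>measure M B - e\<close>
      nonnegative; otherwise \<open>ennreal\<close> would truncate it to 0 and a null set
      \<open>B\<close> would give no contradiction.\<close>
    moreover have "e \<le> measure M B"
      using *[of "{}"] e by (simp add: emeasure_eq_measure)
    ultimately show False
      using e by (simp add: emeasure_eq_measure)
  qed
  then obtain K where K: "compactin T K" "K \<subseteq> B" "emeasure M B < emeasure M K + e" by blast
  have "K \<in> sets M"
    using T M K(1) by (simp add: borel_of_closedin compactin_imp_closedin radon_probD)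
  moreover have "measure M B < measure M K + e"
    using K(3) e by (simp add: emeasure_eq_measure ennreal_less_iff flip: ennreal_plus)
  ultimately show thesis using that K by blast
qed

lemma radon_probI:
  assumes T: "Hausdorff_space T" and M: "sets M = sets (borel_of T)" "prob_space M"
    and inner: "\<And>B e. B \<in> sets M \<Longrightarrow> e > 0 \<Longrightarrow>
      \<exists>K. compactin T K \<and> K \<subseteq> B \<and> measure M B \<le> measure M K + e"
  shows "radon_prob T M"
  unfolding radon_prob_def
proof (intro conjI ballI)
  interpret prob_space M by fact
  fix B assume B: "B \<in> sets M"
  show "emeasure M B = (SUP K\<in>{K. compactin T K \<and> K \<subseteq> B}. emeasure M K)" (is "_ = ?S")
  proof (rule antisym)
    show "?S \<le> emeasure M B" by (intro SUP_least emeasure_mono B) auto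
    show "emeasure M B \<le> ?S"
    proof (rule ennreal_le_epsilon)
      fix e :: real assume "e > 0"
      then obtain K where K: "compactin T K" "K \<subseteq> B" "measure M B \<le> measure M K + e"
        using inner[OF B] by blast
      then have "emeasure M B \<le> emeasure M K + e"
        using \<open>e > 0\<close> by (simp add: emeasure_eq_measure flip: ennreal_plus)
      also have "emeasure M K \<le> ?S" using K by (intro SUP_upper) auto
      finally show "emeasure M B \<le> ?S + e" by (simp add: add_right_mono)
    qed
  qed
qed (use M in auto)

section \<open>Compact sets and their separation by a lattice of open sets\<close>

lemma compactin_pointwise_cover:
  assumes "compactin T K" and "\<And>x. x \<in> K \<Longrightarrow> openin T (V x) \<and> x \<in> V x"
  obtains F where "finite F" "F \<subseteq> K" "K \<subseteq> (\<Union>x\<in>F. V x)"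
proof -
  obtain \<F> where "finite \<F>" "\<F> \<subseteq> V ` K" "K \<subseteq> \<Union>\<F>"
    using compactinD[OF assms(1), of "V ` K"] assms(2) by blast
  then show thesis using that finite_subset_image[of \<F> V K] by metis
qed

text \<open>The complements of the \<open>K n\<close>, each joined with \<open>U\<close>, are open
  because compacts in a Hausdorff space are closed, and they cover \<open>K 0\<close>. A finite
  subcover and monotonicity leave a single index.\<close>

lemma compactin_decseq_subset:
  assumes T: "Hausdorff_space T" and K: "\<And>n::nat. compactin T (K n)"
    and dec: "decseq K" and U: "openin T U" "(\<Inter>n. K n) \<subseteq> U"
  shows "\<exists>n. K n \<subseteq> U"
proof -
  have cl: "closedin T (K n)" for n using T K by (simp add: compactin_imp_closedin)
  have V: "openin T (topspace T - K n \<union> U)" for n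
    using cl U by auto
  have "K 0 \<subseteq> (\<Union>n. topspace T - K n \<union> U)"
    using U compactin_subset_topspace[OF K[of 0]] by blast
  then obtain \<F> where "finite \<F>" "\<F> \<subseteq> range (\<lambda>n. topspace T - K n \<union> U)" "K 0 \<subseteq> \<Union>\<F>"
    using compactinD[OF K[of 0], of "range (\<lambda>n. topspace T - K n \<union> U)"] V by blast
  then obtain N where N: "finite N" "K 0 \<subseteq> (\<Union>n\<in>N. topspace T - K n \<union> U)"
    using finite_subset_image[of \<F> "\<lambda>n. topspace T - K n \<union> U" UNIV] by blast
  \<comment> \<open>Index 0 keeps \<open>K m\<close> inside the covered set \<open>K 0\<close> and
    gives \<open>Max\<close> a non-empty argument when \<open>N\<close> is empty.\<close>
  define m where "m = Max (insert 0 N)"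
  have le: "K m \<subseteq> K n" if "n \<in> insert 0 N" for n
    using dec N that by (auto simp: m_def decseq_def)
  have "K m \<subseteq> U"
  proof
    fix x assume x: "x \<in> K m"
    then have "x \<in> (\<Union>n\<in>N. topspace T - K n \<union> U)" using le[of 0] N(2) by blast
    then show "x \<in> U" using le x by blast
  qed
  then show ?thesis ..
qed

text \<open>Abstracts the open cylinders. The lattice is not assumed to be a base of
  \<open>T\<close>: separation of points passes to disjoint compacts, and by inner regularity this
  is enough to determine a Radon measure.\<close>

locale separating_family =
  fixes T :: "'a topology" and \<U> :: "'a set set"
  assumes Hausdorff: "Hausdorff_space T"
    and open_mem: "U \<in> \<U> \<Longrightarrow> openin T U"
    and empty_mem: "{} \<in> \<U>" and top_mem: "topspace T \<in> \<U>"
    and Un_mem: "U \<in> \<U> \<Longrightarrow> V \<in> \<U> \<Longrightarrow> U \<union> V \<in> \<U>"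
    and Int_mem: "U \<in> \<U> \<Longrightarrow> V \<in> \<U> \<Longrightarrow> U \<inter> V \<in> \<U>"
    and separates: "x \<in> topspace T \<Longrightarrow> y \<in> topspace T \<Longrightarrow> x \<noteq> y \<Longrightarrow>
      \<exists>U\<in>\<U>. \<exists>V\<in>\<U>. x \<in> U \<and> y \<in> V \<and> U \<inter> V = {}"
begin

lemma finite_UN_mem: "finite F \<Longrightarrow> (\<And>x. x \<in> F \<Longrightarrow> V x \<in> \<U>) \<Longrightarrow> (\<Union>x\<in>F. V x) \<in> \<U>"
  by (induction F rule: finite_induct) (auto simp: empty_mem Un_mem)

lemma finite_INT_mem:
  \<comment> \<open>The factor \<open>topspace T\<close> covers the empty index set, whose
    intersection is \<open>UNIV\<close>.\<close>
  "finite F \<Longrightarrow> (\<And>x. x \<in> F \<Longrightarrow> V x \<in> \<U>) \<Longrightarrow> topspace T \<inter> (\<Inter>x\<in>F. V x) \<in> \<U>"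
proof (induction F rule: finite_induct)
  case (insert x F)
  then show ?case
    using Int_mem[of "V x" "topspace T \<inter> (\<Inter>x\<in>F. V x)"] by (simp add: Int_left_commute)
qed (simp add: top_mem)

lemma separates_point_compact:
  assumes x: "x \<in> topspace T" and K: "compactin T K" "x \<notin> K"
  obtains U V where "U \<in> \<U>" "V \<in> \<U>" "x \<in> U" "K \<subseteq> V" "U \<inter> V = {}"
proof -
  have "\<exists>U\<in>\<U>. \<exists>V\<in>\<U>. x \<in> U \<and> y \<in> V \<and> U \<inter> V = {}" if "y \<in> K" for y
    using separates[of x y] x that K compactin_subset_topspace by blast
  then obtain U V where UV: "\<And>y. y \<in> K \<Longrightarrow> U y \<in> \<U> \<and> V y \<in> \<U> \<and> x \<in> U y \<and> y \<in> V y \<and> U y \<inter> V y = {}"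
    by metis
  obtain F where F: "finite F" "F \<subseteq> K" "K \<subseteq> (\<Union>y\<in>F. V y)"
    using compactin_pointwise_cover[OF K(1), of V] UV open_mem by metis
  have UVF: "U y \<in> \<U>" "V y \<in> \<U>" "x \<in> U y" "U y \<inter> V y = {}" if "y \<in> F" for y
    using UV[of y] F(2) that by auto
  show thesis
  proof (rule that)
    show "topspace T \<inter> (\<Inter>y\<in>F. U y) \<in> \<U>" by (intro finite_INT_mem F UVF)
    show "(\<Union>y\<in>F. V y) \<in> \<U>" by (intro finite_UN_mem F UVF)
    show "topspace T \<inter> (\<Inter>y\<in>F. U y) \<inter> (\<Union>y\<in>F. V y) = {}" using UVF(4) by fastforce
  qed (use x UVF F in auto)
qed

lemma separates_compacts:
  assumes K: "compactin T K" "compactin T K'" "K \<inter> K' = {}"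
  obtains U V where "U \<in> \<U>" "V \<in> \<U>" "K \<subseteq> U" "K' \<subseteq> V" "U \<inter> V = {}"
proof -
  have "\<exists>U\<in>\<U>. \<exists>V\<in>\<U>. x \<in> U \<and> K' \<subseteq> V \<and> U \<inter> V = {}" if "x \<in> K" for x
  proof -
    have "x \<in> topspace T" "x \<notin> K'" using K that compactin_subset_topspace by blast+
    then show ?thesis using separates_point_compact[of x K'] K(2) by metis
  qed
  then obtain U V where UV: "\<And>y. y \<in> K \<Longrightarrow> U y \<in> \<U> \<and> V y \<in> \<U> \<and> y \<in> U y \<and> K' \<subseteq> V y \<and> U y \<inter> V y = {}"
    by metis
  obtain F where F: "finite F" "F \<subseteq> K" "K \<subseteq> (\<Union>y\<in>F. U y)"
    using compactin_pointwise_cover[OF K(1), of U] UV open_mem by metis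
  have UVF: "U y \<in> \<U>" "V y \<in> \<U>" "K' \<subseteq> V y" "U y \<inter> V y = {}" if "y \<in> F" for y
    using UV[of y] F(2) that by auto
  show thesis
  proof (rule that)
    show "(\<Union>y\<in>F. U y) \<in> \<U>" by (intro finite_UN_mem F UVF)
    show "topspace T \<inter> (\<Inter>y\<in>F. V y) \<in> \<U>" by (intro finite_INT_mem F UVF)
    show "(\<Union>y\<in>F. U y) \<inter> (topspace T \<inter> (\<Inter>y\<in>F. V y)) = {}" using UVF(4) by fastforce
    show "K' \<subseteq> topspace T \<inter> (\<Inter>y\<in>F. V y)"
      using compactin_subset_topspace[OF K(2)] UVF(3) by blast
  qed (use F in auto)
qed

text \<open>Put most of the \<open>N\<close>-mass outside \<open>K\<close> into a compact
  \<open>D\<close> and separate \<open>K\<close> from \<open>D\<close> by some \<open>U\<close> in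
  the family. Then \<open>M\<close> gives \<open>K\<close> at most the common mass of
  \<open>U\<close>, and since \<open>U\<close> misses \<open>D\<close>, this exceeds the
  \<open>N\<close>-mass of \<open>K\<close> by at most \<open>e\<close>. Symmetry gives agreement on
  compacts, hence everywhere.\<close>

lemma radon_prob_unique:
  assumes M: "radon_prob T M" and N: "radon_prob T N"
    and eq: "\<And>U. U \<in> \<U> \<Longrightarrow> measure M U = measure N U"
  shows "M = N"
proof -
  have *: "measure M K \<le> measure N K"
    if M: "radon_prob T M" and N: "radon_prob T N" and K: "compactin T K"
      and eq: "\<And>U. U \<in> \<U> \<Longrightarrow> measure M U = measure N U" for M N K
  proof (rule field_le_epsilon)
    fix e :: real assume e: "e > 0"
    interpret M: prob_space M using M by (simp add: radon_prob_def)
    interpret N: prob_space N using N by (simp add: radon_prob_def)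
    note sM = radon_probD[OF M] and sN = radon_probD[OF N]
    have Ks: "K \<in> sets N"
      using Hausdorff K sN by (simp add: borel_of_closedin compactin_imp_closedin)
    obtain D where D: "compactin T D" "D \<subseteq> space N - K" "D \<in> sets N"
        "measure N (space N - K) < measure N D + e"
      using radon_prob_inner[OF Hausdorff N _ e, of "space N - K"] Ks by blast
    obtain U V where UV: "U \<in> \<U>" "V \<in> \<U>" "K \<subseteq> U" "D \<subseteq> V" "U \<inter> V = {}"
      using separates_compacts[of K D] K D by blast
    have sets: "U \<in> sets N" "U \<in> sets M"
      using borel_of_openin[OF open_mem[OF UV(1)]] sM(1) sN(1) by auto
    have "measure M K \<le> measure M U"
      using UV sets by (intro M.finite_measure_mono) auto
    also have "\<dots> = measure N U" using eq UV by blast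
    also have "\<dots> \<le> measure N (space N - D)"
      using UV D sets sets.sets_into_space[OF sets(1)]
      by (intro N.finite_measure_mono) auto
    also have "\<dots> \<le> measure N K + e"
      using D(4) N.prob_compl[OF D(3)] N.prob_compl[OF Ks] by simp
    finally show "measure M K \<le> measure N K + e" .
  qed
  interpret M: prob_space M using M by (simp add: radon_prob_def)
  interpret N: prob_space N using N by (simp add: radon_prob_def)
  have "measure M K = measure N K" if "compactin T K" for K
    using *[OF M N that eq] *[OF N M that eq[symmetric]] by simp
  then have "emeasure M K = emeasure N K" if "compactin T K" for K
    using that by (simp add: M.emeasure_eq_measure N.emeasure_eq_measure)
  then have SUP_eq: "(SUP K\<in>{K. compactin T K \<and> K \<subseteq> B}. emeasure M K)
      = (SUP K\<in>{K. compactin T K \<and> K \<subseteq> B}. emeasure N K)" for B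
    by (intro SUP_cong) auto
  show ?thesis
  proof (rule measure_eqI)
    show "sets M = sets N" using M N by (simp only: radon_probD(1))
    then show "emeasure M B = emeasure N B" if "B \<in> sets M" for B
      using M N SUP_eq[of B] that unfolding radon_prob_def by metis
  qed
qed

end

section \<open>Extension of tight contents\<close>

text \<open>\<open>m\<close> is only finitely additive; \<open>tight\<close> takes the place of
  countable additivity. An algebra accompanies the lattice because complements of members of
  \<open>\<U>\<close> need a mass as well.\<close>

locale tight_content = separating_family +
  fixes \<Z> :: "'a set set" and m :: "'a set \<Rightarrow> real"
  assumes algebra: "algebra (topspace T) \<Z>"
    and family_subset: "\<U> \<subseteq> \<Z>"
    and m_nonneg: "Z \<in> \<Z> \<Longrightarrow> 0 \<le> m Z"
    and m_top: "m (topspace T) = 1"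
    and m_add: "Z \<in> \<Z> \<Longrightarrow> Z' \<in> \<Z> \<Longrightarrow> Z \<inter> Z' = {} \<Longrightarrow> m (Z \<union> Z') = m Z + m Z'"
    and tight: "e > 0 \<Longrightarrow> \<exists>C. compactin T C \<and> (\<forall>Z\<in>\<Z>. Z \<inter> C = {} \<longrightarrow> m Z \<le> e)"
begin

sublocale Z: algebra "topspace T" \<Z>
  by (rule algebra)

lemma family_mem: "U \<in> \<U> \<Longrightarrow> U \<in> \<Z>"
  using family_subset by blast

lemma m_mono:
  assumes "Z \<in> \<Z>" "Z' \<in> \<Z>" "Z \<subseteq> Z'"
  shows "m Z \<le> m Z'"
proof -
  have "m (Z \<union> (Z' - Z)) = m Z + m (Z' - Z)"
    using assms by (intro m_add) auto
  moreover have "Z \<union> (Z' - Z) = Z'" using assms by blast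
  ultimately show ?thesis using m_nonneg[OF Z.Diff[OF assms(2,1)]] by simp
qed

lemma m_empty: "m {} = 0"
  using m_add[of "{}" "{}"] by simp

lemma m_Un_Int:
  assumes "Z \<in> \<Z>" "Z' \<in> \<Z>"
  shows "m (Z \<union> Z') + m (Z \<inter> Z') = m Z + m Z'"
proof -
  have "m (Z \<union> (Z' - Z)) = m Z + m (Z' - Z)"
    using assms by (intro m_add) auto
  moreover have "m ((Z \<inter> Z') \<union> (Z' - Z)) = m (Z \<inter> Z') + m (Z' - Z)"
    using assms by (intro m_add) auto
  moreover have "Z \<union> (Z' - Z) = Z \<union> Z'" "(Z \<inter> Z') \<union> (Z' - Z) = Z'" by auto
  ultimately show ?thesis by simp
qed

lemma m_Diff:
  assumes "Z \<in> \<Z>" "Z' \<in> \<Z>"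
  shows "m (Z - Z') = m Z - m (Z \<inter> Z')"
proof -
  have "m ((Z \<inter> Z') \<union> (Z - Z')) = m (Z \<inter> Z') + m (Z - Z')"
    using assms by (intro m_add) auto
  moreover have "(Z \<inter> Z') \<union> (Z - Z') = Z" by auto
  ultimately show ?thesis by simp
qed

text \<open>\<open>lam K\<close> is the mass of the compact set \<open>K\<close> under the measure to be constructed, and
  \<open>co\<close> below its outer measure, obtained from \<open>lam\<close> by inner regularity on complements.\<close>

definition lam :: "'a set \<Rightarrow> real" where
  "lam K = (INF U\<in>{U\<in>\<U>. K \<subseteq> U}. m U)"

lemma bdd_below_m: "bdd_below (m ` {U\<in>\<U>. K \<subseteq> U})"
  by (rule bdd_belowI[of _ 0]) (auto intro: m_nonneg family_mem)

lemma lam_le: "U \<in> \<U> \<Longrightarrow> K \<subseteq> U \<Longrightarrow> lam K \<le> m U"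
  unfolding lam_def by (intro cINF_lower bdd_below_m) auto

lemma lam_ge:
  "K \<subseteq> topspace T \<Longrightarrow> (\<And>U. U \<in> \<U> \<Longrightarrow> K \<subseteq> U \<Longrightarrow> c \<le> m U) \<Longrightarrow> c \<le> lam K"
  unfolding lam_def using top_mem by (intro cINF_greatest) auto

lemma lam_approx:
  assumes "K \<subseteq> topspace T" "e > 0"
  obtains U where "U \<in> \<U>" "K \<subseteq> U" "m U < lam K + e"
proof -
  have "\<not> (\<forall>U\<in>\<U>. K \<subseteq> U \<longrightarrow> lam K + e \<le> m U)"
    using lam_ge[of K "lam K + e"] assms by auto
  then show thesis using that by (auto simp: not_le)
qed

lemma lam_nonneg: "K \<subseteq> topspace T \<Longrightarrow> 0 \<le> lam K"
  by (rule lam_ge) (auto intro: m_nonneg family_mem)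

lemma lam_le_1: "K \<subseteq> topspace T \<Longrightarrow> lam K \<le> 1"
  using lam_le[OF top_mem] m_top by simp

lemma lam_empty: "lam {} = 0"
  using lam_le[OF empty_mem, of "{}"] lam_nonneg[of "{}"] m_empty by simp

lemma compactin_Diff_open:
  "compactin T K \<Longrightarrow> openin T V \<Longrightarrow> compactin T (K - V)"
proof -
  assume K: "compactin T K" and V: "openin T V"
  have "compactin T (K \<inter> (topspace T - V))"
    by (rule compact_Int_closedin[OF K]) (use V in blast)
  moreover have "K \<inter> (topspace T - V) = K - V" using compactin_subset_topspace[OF K] by blast
  ultimately show ?thesis by simp
qed

lemma compactin_INT:
  assumes "\<And>i. i \<in> I \<Longrightarrow> compactin T (K i)" "I \<noteq> {}"
  shows "compactin T (\<Inter>i\<in>I. K i)"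
proof -
  obtain j where j: "j \<in> I" using assms by blast
  have "closedin T (\<Inter>i\<in>I. K i)"
    using assms Hausdorff by (intro closedin_INT compactin_imp_closedin) auto
  moreover have "(\<Inter>i\<in>I. K i) \<subseteq> K j" using j by blast
  ultimately show ?thesis using assms(1)[OF j] closed_compactin by blast
qed

text \<open>For the complementary mass \<open>1 - lam\<close> this is finite subadditivity. Outside
  a neighbourhood \<open>V\<close> of \<open>K \<inter> K'\<close> the two compacts are disjoint, so
  they lie in \<open>G \<union> V\<close> and \<open>G' \<union> V\<close>, which meet in
  \<open>V\<close> only; modularity of \<open>m\<close> does the rest.\<close>

lemma lam_Int:
  assumes K: "compactin T K" "compactin T K'"
  shows "lam K + lam K' \<le> 1 + lam (K \<inter> K')"
proof -
  have "lam K + lam K' - 1 \<le> m V" if V: "V \<in> \<U>" "K \<inter> K' \<subseteq> V" for V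
  proof -
    obtain G G' where G: "G \<in> \<U>" "G' \<in> \<U>" "K - V \<subseteq> G" "K' - V \<subseteq> G'" "G \<inter> G' = {}"
      using separates_compacts[OF K[THEN compactin_Diff_open, OF open_mem[OF V(1)]]] V(2) by blast
    have "lam K \<le> m (G \<union> V)" "lam K' \<le> m (G' \<union> V)"
      using G V by (auto intro!: lam_le Un_mem)
    moreover have "m ((G \<union> V) \<union> (G' \<union> V)) + m ((G \<union> V) \<inter> (G' \<union> V)) = m (G \<union> V) + m (G' \<union> V)"
      using G V by (intro m_Un_Int family_mem Un_mem)
    moreover have "(G \<union> V) \<inter> (G' \<union> V) = V" using G by blast
    moreover have "m ((G \<union> V) \<union> (G' \<union> V)) \<le> 1"
      unfolding m_top[symmetric] using G V openin_subset[OF open_mem]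
      by (intro m_mono family_mem Un_mem top_mem) simp_all
    ultimately show ?thesis by simp
  qed
  then have "lam K + lam K' - 1 \<le> lam (K \<inter> K')"
    using compactin_subset_topspace[OF K(1)] by (intro lam_ge) auto
  then show ?thesis by simp
qed

lemma lam_INT_atMost:
  assumes "\<And>i::nat. compactin T (K i)"
  shows "1 - lam (\<Inter>i\<le>n. K i) \<le> (\<Sum>i\<le>n. 1 - lam (K i))"
proof (induction n)
  case (Suc n)
  have "compactin T (\<Inter>i\<le>n. K i)"
    using assms by (intro compactin_INT) auto
  then have "lam (\<Inter>i\<le>n. K i) + lam (K (Suc n)) \<le> 1 + lam ((\<Inter>i\<le>n. K i) \<inter> K (Suc n))"
    by (rule lam_Int[OF _ assms])
  moreover have "(\<Inter>i\<le>n. K i) \<inter> K (Suc n) = (\<Inter>i\<le>Suc n. K i)"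
    by (auto simp: atMost_Suc)
  ultimately show ?case using Suc by simp
qed simp

text \<open>Compactness reduces the countable intersection to a finite one: an open set around all
  of it already contains a partial intersection.\<close>

lemma lam_INT:
  assumes K: "\<And>i::nat. compactin T (K i)" and U: "U \<in> \<U>" "(\<Inter>i. K i) \<subseteq> U"
  shows "\<exists>n. 1 - m U \<le> (\<Sum>i\<le>n. 1 - lam (K i))"
proof -
  have "compactin T (\<Inter>i\<le>n. K i)" for n
    using K by (intro compactin_INT) auto
  moreover have "decseq (\<lambda>n. \<Inter>i\<le>n. K i)"
    by (rule decseq_SucI) (auto simp: atMost_Suc)
  moreover have "(\<Inter>n. \<Inter>i\<le>n. K i) \<subseteq> U" using U by blast
  ultimately have "\<exists>n. (\<Inter>i\<le>n. K i) \<subseteq> U"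
    by (rule compactin_decseq_subset[OF Hausdorff _ _ open_mem[OF U(1)]])
  then obtain n where "(\<Inter>i\<le>n. K i) \<subseteq> U" ..
  then have "lam (\<Inter>i\<le>n. K i) \<le> m U"
    using U by (intro lam_le)
  then show ?thesis using lam_INT_atMost[of K n, OF K] by (intro exI[of _ n]) linarith
qed

section \<open>Outer measure and Caratheodory's condition\<close>

definition co :: "'a set \<Rightarrow> real" where
  "co E = (INF K\<in>{K. compactin T K \<and> K \<inter> E = {}}. 1 - lam K)"

lemma co_le: "compactin T K \<Longrightarrow> K \<inter> E = {} \<Longrightarrow> co E \<le> 1 - lam K"
  unfolding co_def
  by (intro cINF_lower bdd_belowI[of _ 0]) (auto intro!: lam_le_1 compactin_subset_topspace)

lemma co_ge: "(\<And>K. compactin T K \<Longrightarrow> K \<inter> E = {} \<Longrightarrow> c \<le> 1 - lam K) \<Longrightarrow> c \<le> co E"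
  unfolding co_def by (intro cINF_greatest) auto

lemma co_approx:
  assumes "e > 0"
  obtains K where "compactin T K" "K \<inter> E = {}" "1 - lam K < co E + e"
proof -
  have "\<not> (\<forall>K. compactin T K \<longrightarrow> K \<inter> E = {} \<longrightarrow> co E + e \<le> 1 - lam K)"
    using co_ge[of E "co E + e"] assms by auto
  then show thesis using that by (auto simp: not_le)
qed

lemma co_nonneg: "0 \<le> co E"
  by (rule co_ge) (simp add: compactin_subset_topspace lam_le_1)

lemma co_mono: "E \<subseteq> E' \<Longrightarrow> co E \<le> co E'"
  by (rule co_ge) (auto intro: co_le)

lemma co_top: "co (topspace T) = 1"
proof (rule antisym)
  show "co (topspace T) \<le> 1" using co_le[of "{}"] by (simp add: lam_empty)
  show "1 \<le> co (topspace T)"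
  proof (rule co_ge)
    fix K assume "compactin T K" "K \<inter> topspace T = {}"
    then have "K = {}" using compactin_subset_topspace by blast
    then show "1 \<le> 1 - lam K" by (simp add: lam_empty)
  qed
qed

text \<open>Tightness enters here: the complement of any \<open>U\<close> containing
  \<open>C\<close> misses \<open>C\<close>, so its mass is at most \<open>e\<close>.\<close>

lemma co_empty: "co {} = 0"
proof (rule antisym[OF _ co_nonneg], rule field_le_epsilon)
  fix e :: real assume "e > 0"
  then obtain C where C: "compactin T C" "\<And>Z. Z \<in> \<Z> \<Longrightarrow> Z \<inter> C = {} \<Longrightarrow> m Z \<le> e"
    using tight[OF \<open>e > 0\<close>] by blast
  have "1 - e \<le> lam C"
  proof (rule lam_ge)
    fix U assume U: "U \<in> \<U>" "C \<subseteq> U"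
    have "m (topspace T - U) \<le> e" using U(2) by (intro C Z.compl_sets family_mem U(1)) auto
    moreover have "topspace T \<inter> U = U" using openin_subset[OF open_mem[OF U(1)]] by blast
    ultimately show "1 - e \<le> m U" using m_Diff[OF Z.top family_mem[OF U(1)]] m_top by simp
  qed (rule compactin_subset_topspace[OF C(1)])
  then show "co {} \<le> 0 + e" using co_le[OF C(1), of "{}"] by auto
qed

text \<open>Countable subadditivity with a partial sum on the right, which stays meaningful in the
  reals when the series diverges.\<close>

lemma co_UN_le:
  assumes "e > 0"
  shows "\<exists>n. co (\<Union>i::nat. A i) \<le> (\<Sum>i\<le>n. co (A i)) + e"
proof -
  \<comment> \<open>Half of \<open>e\<close> is spread geometrically over the choices of the
    \<open>K i\<close>; the other half pays for the neighbourhood \<open>U\<close> of their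
    intersection.\<close>
  have "\<exists>K. compactin T K \<and> K \<inter> A i = {} \<and> 1 - lam K < co (A i) + e/2 * (1/2)^Suc i" for i
    using co_approx[of "e/2 * (1/2)^Suc i" "A i"] assms by auto
  then obtain K where K: "\<And>i. compactin T (K i)" "\<And>i. K i \<inter> A i = {}"
      "\<And>i. 1 - lam (K i) < co (A i) + e/2 * (1/2)^Suc i" by metis
  have cK: "compactin T (\<Inter>i. K i)" using K by (intro compactin_INT) auto
  obtain U where U: "U \<in> \<U>" "(\<Inter>i. K i) \<subseteq> U" "m U < lam (\<Inter>i. K i) + e/2"
    using lam_approx[OF compactin_subset_topspace[OF cK], of "e/2"] assms by auto
  obtain n where n: "1 - m U \<le> (\<Sum>i\<le>n. 1 - lam (K i))"
    using lam_INT[OF K(1) U(1,2)] by blast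
  have half: "(\<Sum>i\<le>n. (1/2::real)^Suc i) \<le> 1"
  proof -
    have "(\<Sum>i\<le>n. (1/2::real)^Suc i) = 1 - (1/2)^Suc n" by (induction n) auto
    then show ?thesis by simp
  qed
  have "co (\<Union>i. A i) \<le> 1 - lam (\<Inter>i. K i)"
    using K(2) by (intro co_le[OF cK]) fastforce
  also have "\<dots> \<le> (\<Sum>i\<le>n. 1 - lam (K i)) + e/2" using U(3) n by simp
  also have "(\<Sum>i\<le>n. 1 - lam (K i)) \<le> (\<Sum>i\<le>n. co (A i) + e/2 * (1/2)^Suc i)"
    by (intro sum_mono less_imp_le K(3))
  also have "\<dots> = (\<Sum>i\<le>n. co (A i)) + e/2 * (\<Sum>i\<le>n. (1/2)^Suc i)"
    by (simp only: sum.distrib sum_distrib_left)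
  also have "e/2 * (\<Sum>i\<le>n. (1/2::real)^Suc i) \<le> e/2"
    using half assms by (intro mult_left_le) auto
  finally show ?thesis by (intro exI[of _ n]) simp
qed

lemma co_Un_le: "co (A \<union> B) \<le> co A + co B"
proof (rule field_le_epsilon)
  fix e :: real assume "e > 0"
  define S where "S i = (if i = 0 then A else if i = Suc 0 then B else {})" for i
  obtain n where n: "co (\<Union>i. S i) \<le> (\<Sum>i\<le>n. co (S i)) + e"
    using co_UN_le[OF \<open>e > 0\<close>] by blast
  \<comment> \<open>Lengthening the sum guarantees that the indices 0 and 1 both occur, even for
    \<open>n = 0\<close>.\<close>
  have "(\<Sum>i\<le>n. co (S i)) \<le> (\<Sum>i\<le>Suc n. co (S i))" by (simp add: co_nonneg)
  also have "\<dots> = (\<Sum>i\<in>{0, Suc 0}. co (S i))"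
    by (intro sum.mono_neutral_right) (auto simp: S_def co_empty)
  also have "\<dots> = co A + co B" by (simp add: S_def)
  finally have "(\<Sum>i\<le>n. co (S i)) \<le> co A + co B" .
  moreover have "A \<union> B \<subseteq> (\<Union>i. S i)"
    using UN_upper[of 0 UNIV S] UN_upper[of "Suc 0" UNIV S] by (simp add: S_def)
  ultimately show "co (A \<union> B) \<le> co A + co B + e"
    using n co_mono[of "A \<union> B" "\<Union>i. S i"] by linarith
qed

text \<open>The compacts \<open>K1\<close> and \<open>K2\<close> avoid \<open>E \<inter> F\<close>
  and \<open>E - F\<close>. A neighbourhood \<open>U\<close> of \<open>K1\<close> and the set
  \<open>V\<close> together contain \<open>C\<close>, and \<open>U \<inter> V\<close> contains
  \<open>K\<close>; modularity of \<open>m\<close> then bounds \<open>lam K1 + lam K2\<close> from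
  below by \<open>lam K + 1\<close>, up to a small error.\<close>

lemma co_closed_split:
  assumes F: "closedin T F"
  shows "co (E \<inter> F) + co (E - F) \<le> co E"
proof (rule field_le_epsilon)
  fix e :: real assume e: "e > 0"
  obtain K where K: "compactin T K" "K \<inter> E = {}" "1 - lam K < co E + e/3"
    using co_approx[of "e/3" E] e by auto
  obtain C where C: "compactin T C" "\<And>Z. Z \<in> \<Z> \<Longrightarrow> Z \<inter> C = {} \<Longrightarrow> m Z \<le> e/3"
    using tight[of "e/3"] e by auto
  define K2 where "K2 = K \<union> (F \<inter> C)"
  have K2: "compactin T K2"
    unfolding K2_def by (intro compactin_Un K closed_Int_compactin F C)
  obtain V where V: "V \<in> \<U>" "K2 \<subseteq> V" "m V < lam K2 + e/3"
    using lam_approx[OF compactin_subset_topspace[OF K2], of "e/3"] e by auto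
  \<comment> \<open>\<open>C - F\<close> would be the natural counterpart of
    \<open>F \<inter> C\<close> but need not be compact. Removing the open set \<open>V\<close>,
    which contains \<open>F \<inter> C\<close>, leaves a compact set that is still disjoint from
    \<open>F\<close>.\<close>
  define K1 where "K1 = K \<union> (C - V)"
  have K1: "compactin T K1"
    unfolding K1_def by (intro compactin_Un K compactin_Diff_open C open_mem V)
  have "lam K + 1 - m V - e/3 \<le> lam K1"
  proof (rule lam_ge)
    fix U assume U: "U \<in> \<U>" "K1 \<subseteq> U"
    note UV = family_mem[OF U(1)] family_mem[OF V(1)]
    have "lam K \<le> m (U \<inter> V)"
      using U V by (intro lam_le Int_mem) (auto simp: K1_def K2_def)
    moreover have "m (U - V) = m U - m (U \<inter> V)" by (intro m_Diff UV)
    moreover have "m (topspace T - V - U) \<le> e/3"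
      using UV U(2) by (intro C Z.Diff) (auto simp: K1_def)
    moreover have "m (topspace T - V - U) = m (topspace T - V) - m ((topspace T - V) \<inter> U)"
      using UV by (intro m_Diff) auto
    moreover have "(topspace T - V) \<inter> U = U - V"
      using openin_subset[OF open_mem[OF U(1)]] by blast
    moreover have "m (topspace T - V) = 1 - m V"
      using m_Diff[OF Z.top UV(2)] m_top openin_subset[OF open_mem[OF V(1)]]
      by (simp add: Int_absorb1)
    ultimately show "lam K + 1 - m V - e/3 \<le> m U" by simp
  qed (rule compactin_subset_topspace[OF K1])
  moreover have "co (E \<inter> F) \<le> 1 - lam K1"
    using K(2) V(2) by (intro co_le K1) (auto simp: K1_def K2_def)
  moreover have "co (E - F) \<le> 1 - lam K2"
    using K(2) by (intro co_le K2) (auto simp: K2_def)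
  ultimately show "co (E \<inter> F) + co (E - F) \<le> co E + e"
    using V(3) K(3) by linarith
qed

section \<open>The Radon measure given by the outer measure\<close>

lemma outer_measure_space_co: "outer_measure_space (Pow (topspace T)) (\<lambda>E. ennreal (co E))"
  unfolding outer_measure_space_def countably_subadditive_def increasing_def positive_def
proof (intro conjI ballI allI impI)
  fix A :: "nat \<Rightarrow> 'a set"
  show "ennreal (co (\<Union>i. A i)) \<le> (\<Sum>i. ennreal (co (A i)))"
  proof (rule ennreal_le_epsilon)
    fix e :: real assume e: "0 < e"
    then obtain n where "co (\<Union>i::nat. A i) \<le> (\<Sum>i\<le>n. co (A i)) + e"
      using co_UN_le by blast
    then have "ennreal (co (\<Union>i. A i)) \<le> ennreal ((\<Sum>i\<le>n. co (A i)) + e)"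
      by (rule ennreal_leI)
    also have "\<dots> = (\<Sum>i\<le>n. ennreal (co (A i))) + e"
      using e by (simp add: co_nonneg sum_nonneg ennreal_plus)
    also have "\<dots> \<le> (\<Sum>i. ennreal (co (A i))) + e"
      by (intro add_right_mono sum_le_suminf) auto
    finally show "ennreal (co (\<Union>i. A i)) \<le> (\<Sum>i. ennreal (co (A i))) + e" .
  qed
qed (auto simp: co_empty intro!: ennreal_leI co_mono)

lemma measure_space_co: "measure_space (topspace T) (sets (borel_of T)) (\<lambda>E. ennreal (co E))"
proof -
  define L where "L = lambda_system (topspace T) (Pow (topspace T)) (\<lambda>E. ennreal (co E))"
  have L: "measure_space (topspace T) L (\<lambda>E. ennreal (co E))"
    unfolding L_def
    by (rule sigma_algebra.caratheodory_lemma[OF sigma_algebra_Pow outer_measure_space_co])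
  then interpret L: sigma_algebra "topspace T" L by (simp add: measure_space_def)
  have "F \<in> L" if F: "closedin T F" for F
    unfolding L_def lambda_system_def
  proof (intro CollectI conjI ballI)
    fix E assume "E \<in> Pow (topspace T)"
    then have E: "F \<inter> E = E \<inter> F" "(topspace T - F) \<inter> E = E - F" by auto
    have "(E \<inter> F) \<union> (E - F) = E" by blast
    then have "co E \<le> co (E \<inter> F) + co (E - F)" using co_Un_le[of "E \<inter> F" "E - F"] by simp
    then have "co (E \<inter> F) + co (E - F) = co E" using co_closed_split[OF F, of E] by simp
    then show "ennreal (co (F \<inter> E)) + ennreal (co ((topspace T - F) \<inter> E)) = ennreal (co E)"
      unfolding E by (simp add: co_nonneg flip: ennreal_plus)
  qed (use F closedin_subset in blast)
  then have "topspace T - (topspace T - U) \<in> L" if "openin T U" for U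
    using that by (intro L.compl_sets[of "topspace T - U"]) auto
  then have "{U. openin T U} \<subseteq> L"
    using double_diff[OF openin_subset order_refl] by fastforce
  then have "sets (borel_of T) \<subseteq> L"
    unfolding sets_borel_of by (rule L.sigma_sets_subset)
  then show ?thesis
    using L sets.sigma_algebra_axioms[of "borel_of T"]
    by (intro measure_down[OF L]) simp_all
qed

text \<open>\<open>m\<close> is not assumed to be approximable from inside by compacts, so an open
  \<open>U\<close> may receive less than \<open>m U\<close>. For open cylinders, equality is
  recovered in \<open>projecting_exists\<close>.\<close>

theorem radon_extension: "\<exists>M. radon_prob T M \<and> (\<forall>U\<in>\<U>. measure M U \<le> m U)"
proof -
  define M where "M = measure_of (topspace T) (sets (borel_of T)) (\<lambda>E. ennreal (co E))"
  have sM: "sets M = sets (borel_of T)" "space M = topspace T"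
    unfolding M_def using sets.space_closed[of "borel_of T"] sets.sigma_sets_eq[of "borel_of T"]
    by (simp_all add: sets_measure_of_conv space_measure_of_conv)
  have eM: "emeasure M B = ennreal (co B)" if "B \<in> sets M" for B
    using measure_space_co that sets.space_closed[of "borel_of T"] unfolding M_def sM(1)[unfolded M_def]
    by (intro emeasure_measure_of_sigma) (auto simp: measure_space_def)
  have "emeasure M (space M) = 1" using eM[OF sets.top] by (simp add: sM(2) co_top)
  then interpret prob_space M by (rule prob_spaceI)
  have co_M: "measure M B = co B" if "B \<in> sets M" for B
    using eM[OF that] by (simp add: measure_def co_nonneg)
  have M_co: "measure M B = 1 - co (topspace T - B)" if "B \<in> sets M" for B
    using prob_compl[OF that] co_M[OF sets.compl_sets[OF that]] by (simp add: sM(2))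
  have K_sets: "K \<in> sets M" if "compactin T K" for K
    using Hausdorff that by (simp add: sM borel_of_closedin compactin_imp_closedin)
  have "radon_prob T M"
  proof (rule radon_probI[OF Hausdorff sM(1) prob_space_axioms])
    fix B and e :: real assume B: "B \<in> sets M" and "e > 0"
    obtain K where K: "compactin T K" "K \<inter> (topspace T - B) = {}" "1 - lam K < co (topspace T - B) + e"
      using co_approx[OF \<open>e > 0\<close>] by blast
    have "K \<subseteq> B" using K compactin_subset_topspace by blast
    \<comment> \<open>\<open>K\<close> itself is one of the compacts missing the complement of
      \<open>K\<close> in the infimum \<open>co\<close>.\<close>
    moreover have "lam K \<le> measure M K"
      using M_co[OF K_sets[OF K(1)]] co_le[OF K(1), of "topspace T - K"] by auto
    ultimately show "\<exists>K. compactin T K \<and> K \<subseteq> B \<and> measure M B \<le> measure M K + e"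
      using K M_co[OF B] by (intro exI[of _ K]) auto
  qed
  moreover have "measure M U \<le> m U" if U: "U \<in> \<U>" for U
  proof -
    have "1 - m U \<le> co (topspace T - U)"
    proof (rule co_ge)
      fix K assume "compactin T K" "K \<inter> (topspace T - U) = {}"
      then have "K \<subseteq> U" using compactin_subset_topspace by blast
      then show "1 - m U \<le> 1 - lam K" using lam_le[OF U] by simp
    qed
    then show ?thesis using M_co[of U] U by (simp add: sM borel_of_openin open_mem)
  qed
  ultimately show ?thesis by blast
qed

end

section \<open>Compact sets of dominated measures\<close>

lemma M1_D:
  assumes "P \<in> M1 X"
  shows "radon_prob X P" "prob_space P" "sets P = sets (borel_of X)" "space P = topspace X"
  using assms radon_probD[of X P] by (auto simp: M1_def)

lemma openin_weak_integral:
  fixes h :: "'a \<Rightarrow> real"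
  assumes "h \<in> borel_measurable (borel_of X)" "bounded (h ` topspace X)" "open U"
  shows "openin (weak_top X) {P \<in> M1 X. (\<integral>x. h x \<partial>P) \<in> U}"
  unfolding weak_top_def
  by (intro topology_generated_by_Basis CollectI exI[of _ h] exI[of _ U] conjI refl assms)

lemma topspace_weak_top [simp]: "topspace (weak_top X) = M1 X"
proof
  show "topspace (weak_top X) \<subseteq> M1 X"
    unfolding weak_top_def topology_generated_by_topspace by blast
  have "openin (weak_top X) {P \<in> M1 X. (\<integral>x. (0::real) \<partial>P) \<in> UNIV}"
    by (rule openin_weak_integral) (auto simp: bounded_iff)
  then show "M1 X \<subseteq> topspace (weak_top X)"
    using openin_subset by fastforce
qed

text \<open>Indicators of Borel sets are admissible test functions of this topology. With continuous
  test functions only, evaluation at \<open>B\<close> would in general not be continuous.\<close>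

lemma continuous_map_measure:
  assumes "B \<in> sets (borel_of X)"
  shows "continuous_map (weak_top X) euclideanreal (\<lambda>P. measure P B)"
proof (clarsimp simp: continuous_map_def)
  fix U :: "real set" assume "open U"
  then have "openin (weak_top X) {P \<in> M1 X. (\<integral>x. indicator B x \<partial>P) \<in> U}"
    using assms by (intro openin_weak_integral) (auto simp: bounded_iff indicator_def intro!: exI[of _ 1])
  moreover have "(\<integral>x. indicator B x \<partial>P) = measure P B" if "P \<in> M1 X" for P
    using M1_D[OF that] sets.sets_into_space[OF assms] by (simp add: Int_absorb2)
  ultimately show "openin (weak_top X) {P \<in> M1 X. measure P B \<in> U}"
    by (simp cong: conj_cong)
qed

section \<open>Integrals as uniform limits of combinations of evaluations\<close>

lemma bounded_borel_simple_approx: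
  fixes h :: "'a \<Rightarrow> real"
  assumes h: "h \<in> borel_measurable (borel_of X)" "bounded (h ` topspace X)" and e: "e > 0"
  obtains I :: "int set" and c B where "finite I" "\<And>i. B i \<in> sets (borel_of X)"
    "\<And>x. x \<in> topspace X \<Longrightarrow> \<bar>h x - (\<Sum>i\<in>I. c i * indicator (B i) x)\<bar> \<le> e"
proof -
  obtain M where M: "\<And>x. x \<in> topspace X \<Longrightarrow> \<bar>h x\<bar> \<le> M"
    using h(2) by (auto simp: bounded_iff)
  \<comment> \<open>Rounds \<open>h\<close> down to integer multiples of \<open>e\<close>;
    boundedness leaves finitely many relevant level sets.\<close>
  define B where "B i = {x \<in> space (borel_of X). \<lfloor>h x / e\<rfloor> = i}" for i :: int
  define I where "I = {\<lfloor>- M / e\<rfloor> .. \<lfloor>M / e\<rfloor>}"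
  show thesis
  proof (rule that)
    show "finite I" by (simp add: I_def)
    show "B i \<in> sets (borel_of X)" for i
      using h(1) unfolding B_def by measurable
    fix x assume x: "x \<in> topspace X"
    have "\<lfloor>h x / e\<rfloor> \<in> I"
      using M[OF x] e divide_right_mono[of "- M" "h x" e] unfolding I_def
      by (auto intro!: floor_mono divide_right_mono)
    then have "(\<Sum>i\<in>I. (e * of_int i) * indicator (B i) x) = e * of_int \<lfloor>h x / e\<rfloor>"
      using x by (subst sum.remove[of _ "\<lfloor>h x / e\<rfloor>"]) (auto simp: I_def B_def intro!: sum.neutral)
    moreover have "of_int \<lfloor>h x / e\<rfloor> * e \<le> h x" "h x \<le> (of_int \<lfloor>h x / e\<rfloor> + 1) * e"
      using floor_divide_lower[OF e, of "h x"] floor_divide_upper[OF e, of "h x"] by simp_all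
    ultimately show "\<bar>h x - (\<Sum>i\<in>I. (e * of_int i) * indicator (B i) x)\<bar> \<le> e"
      by (simp add: algebra_simps abs_le_iff)
  qed
qed

lemma simple_approx_integral:
  fixes h :: "'a \<Rightarrow> real"
  assumes P: "P \<in> M1 X" and h: "h \<in> borel_measurable (borel_of X)" "bounded (h ` topspace X)"
    and I: "finite I" "\<And>i. B i \<in> sets (borel_of X)"
    and approx: "\<And>x. x \<in> topspace X \<Longrightarrow> \<bar>h x - (\<Sum>i\<in>I. c i * indicator (B i) x)\<bar> \<le> e"
  shows "\<bar>(\<integral>x. h x \<partial>P) - (\<Sum>i\<in>I. c i * measure P (B i))\<bar> \<le> e"
proof -
  note P' = M1_D[OF P]
  interpret prob_space P by (rule P')
  have hP: "h \<in> borel_measurable P" using h(1) measurable_cong_sets[OF P'(3) refl] by blast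
  obtain M where M: "\<And>x. x \<in> topspace X \<Longrightarrow> \<bar>h x\<bar> \<le> M"
    using h(2) by (auto simp: bounded_iff)
  have ih: "integrable P h"
    by (rule integrable_const_bound[of _ M]) (use M hP P' in auto)
  have iB: "integrable P (\<lambda>x. c i * indicator (B i) x)" for i
    using I(2)[of i] P'(3) by (intro integrable_mult_right) (auto simp: emeasure_eq_measure)
  define s where "s x = (\<Sum>i\<in>I. c i * indicator (B i) x)" for x
  have int_s: "integrable P s"
    unfolding s_def using iB by (intro Bochner_Integration.integrable_sum)
  have "(\<integral>x. s x \<partial>P) = (\<Sum>i\<in>I. c i * measure P (B i))"
    unfolding s_def using I(2) P'(3)
    by (subst Bochner_Integration.integral_sum[OF iB]) auto
  then have "\<bar>(\<integral>x. h x \<partial>P) - (\<Sum>i\<in>I. c i * measure P (B i))\<bar> = \<bar>\<integral>x. h x - s x \<partial>P\<bar>"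
    using ih int_s by simp
  also have "\<dots> \<le> (\<integral>x. \<bar>h x - s x\<bar> \<partial>P)" by simp
  also have "\<dots> \<le> (\<integral>x. e \<partial>P)"
    using approx P'(4) by (intro integral_mono integrable_abs Bochner_Integration.integrable_diff ih int_s)
      (auto simp: s_def)
  finally show ?thesis by (simp add: prob_space)
qed

lemma radon_prob_dominated:
  assumes X: "Hausdorff_space X" and Q: "radon_prob X Q"
    and P: "prob_space P" "sets P = sets (borel_of X)"
    and dom: "\<And>e. e > 0 \<Longrightarrow> \<exists>L. \<forall>B\<in>sets (borel_of X). measure P B \<le> L * measure Q B + e"
  shows "radon_prob X P"
proof (rule radon_probI[OF X P(2,1)])
  fix B and e :: real assume B: "B \<in> sets P" and e: "e > 0"
  interpret P: prob_space P by fact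
  interpret Q: prob_space Q using Q by (simp add: radon_prob_def)
  have sQ: "sets Q = sets P" using radon_probD[OF Q] P by simp
  obtain L where L: "\<And>B. B \<in> sets P \<Longrightarrow> measure P B \<le> L * measure Q B + e/2"
    using dom[of "e/2"] e P by auto
  \<comment> \<open>The hypothesis gives no lower bound for \<open>L\<close>; the maximum with 1
    makes \<open>e/(2*L')\<close> a positive tolerance.\<close>
  define L' where "L' = max L 1"
  have L': "L' \<ge> L" "L' > 0" by (auto simp: L'_def)
  obtain K where K: "compactin X K" "K \<subseteq> B" "K \<in> sets Q" "measure Q B < measure Q K + e/(2*L')"
    using radon_prob_inner[OF X Q, of B "e/(2*L')"] B sQ e L' by auto
  have "measure P B - measure P K = measure P (B - K)"
    using B K sQ by (intro P.finite_measure_Diff[symmetric]) auto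
  also have "\<dots> \<le> L * measure Q (B - K) + e/2" using B K sQ by (intro L) auto
  also have "\<dots> \<le> L' * measure Q (B - K) + e/2" using L' by (simp add: mult_right_mono)
  also have "measure Q (B - K) = measure Q B - measure Q K"
    using B K sQ by (intro Q.finite_measure_Diff) auto
  also have "L' * (measure Q B - measure Q K) \<le> L' * (e/(2*L'))"
    using K(4) L' by (intro mult_left_mono) auto
  also have "\<dots> = e/2" using L' by simp
  finally show "\<exists>K. compactin X K \<and> K \<subseteq> B \<and> measure P B \<le> measure P K + e"
    using K by (intro exI[of _ K]) auto
qed

text \<open>For \<open>d\<close> tending to 0 this is uniform absolute continuity with respect to
  \<open>Q\<close>. The bounds range over all Borel sets and mention no partition, so one set serves
  every \<open>\<alpha>\<close>.\<close>

definition dominated_set ::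
  "'a topology \<Rightarrow> 'a measure \<Rightarrow> (nat \<Rightarrow> real) \<Rightarrow> (nat \<Rightarrow> real) \<Rightarrow> 'a measure set" where
  "dominated_set X Q L d =
     {P \<in> M1 X. \<forall>k. \<forall>B\<in>sets (borel_of X). measure P B \<le> L k * measure Q B + d k}"

text \<open>The image of \<open>dominated_set\<close> in the compact cube \<open>[0,1]\<^sup>\<B>\<close> over the Borel sets; domination makes
  its finitely additive members countably additive.\<close>

definition charges ::
  "'a topology \<Rightarrow> 'a measure \<Rightarrow> (nat \<Rightarrow> real) \<Rightarrow> (nat \<Rightarrow> real) \<Rightarrow> ('a set \<Rightarrow> real) set" where
  "charges X Q L d = {p \<in> (\<Pi>\<^sub>E B\<in>sets (borel_of X). {0..1}). p (topspace X) = 1 \<and>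
     (\<forall>A\<in>sets (borel_of X). \<forall>B\<in>sets (borel_of X). A \<inter> B = {} \<longrightarrow> p (A \<union> B) = p A + p B) \<and>
     (\<forall>k. \<forall>B\<in>sets (borel_of X). p B \<le> L k * measure Q B + d k)}"

text \<open>Each condition beyond membership in the cube involves finitely many coordinates and is
  therefore closed, and the cube is compact by Tychonoff. Countable additivity is not of this kind;
  it is recovered in the lemma \<open>charge_measure\<close>.\<close>

lemma compactin_charges:
  "compactin (powertop_real (sets (borel_of X))) (charges X Q L d)"
proof -
  let ?S = "sets (borel_of X)"
  let ?Z = "powertop_real ?S"
  have pr: "continuous_map ?Z euclideanreal (\<lambda>p. p B)" if "B \<in> ?S" for B
    using that by (rule continuous_map_product_projection)
  define \<F> where "\<F> = {{p \<in> topspace ?Z. p (topspace X) = 1}}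
    \<union> (\<lambda>(A, B). {p \<in> topspace ?Z. p (A \<union> B) = p A + p B})
        ` {(A, B). A \<in> ?S \<and> B \<in> ?S \<and> A \<inter> B = {}}
    \<union> (\<lambda>(k, B). {p \<in> topspace ?Z. p B \<le> L k * measure Q B + d k}) ` (UNIV \<times> ?S)"
  have top: "topspace X \<in> ?S" using sets.top[of "borel_of X"] by simp
  have 1: "closedin ?Z {p \<in> topspace ?Z. p (topspace X) = 1}"
    using closedin_continuous_maps_eq[OF _ pr[OF top], of "\<lambda>_. 1"] by simp
  have 2: "closedin ?Z {p \<in> topspace ?Z. p (A \<union> B) = p A + p B}" if "A \<in> ?S" "B \<in> ?S" for A B
    using that by (intro closedin_continuous_maps_eq[of euclideanreal] continuous_map_add pr) auto
  have 3: "closedin ?Z {p \<in> topspace ?Z. p B \<le> c}" if "B \<in> ?S" for B c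
    using closedin_continuous_map_preimage[OF pr[OF that], of "{..c}"] by simp
  have "closedin ?Z (\<Inter>\<F>)"
    using 1 2 3 unfolding \<F>_def by (intro closedin_Inter) auto
  moreover have "compactin ?Z (\<Pi>\<^sub>E B\<in>?S. {0..1})"
    by (subst compactin_PiE) auto
  moreover have "charges X Q L d = (\<Pi>\<^sub>E B\<in>?S. {0..1}) \<inter> \<Inter>\<F>"
  proof -
    have *: "(\<Pi>\<^sub>E B\<in>?S. {0..1::real}) \<subseteq> topspace ?Z" by (auto simp: PiE_iff)
    show ?thesis
    proof (rule set_eqI)
      fix p show "p \<in> charges X Q L d \<longleftrightarrow> p \<in> (\<Pi>\<^sub>E B\<in>?S. {0..1}) \<inter> \<Inter>\<F>"
      proof (cases "p \<in> (\<Pi>\<^sub>E B\<in>?S. {0..1})")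
        case True
        then have p: "p \<in> topspace ?Z" using * by blast
        show ?thesis
          unfolding charges_def \<F>_def Inter_Un_distrib using True p by auto
      qed (simp add: charges_def)
    qed
  qed
  ultimately show ?thesis by (simp add: compact_Int_closedin)
qed

definition charge_measure :: "'a topology \<Rightarrow> ('a set \<Rightarrow> real) \<Rightarrow> 'a measure" where
  "charge_measure X p = measure_of (topspace X) (sets (borel_of X)) (\<lambda>B. ennreal (p B))"

lemma sets_charge_measure: "sets (charge_measure X p) = sets (borel_of X)"
  and space_charge_measure: "space (charge_measure X p) = topspace X"
  unfolding charge_measure_def using sets.space_closed[of "borel_of X"] sets.sigma_sets_eq[of "borel_of X"]
  by (simp_all add: sets_measure_of_conv space_measure_of_conv)

text \<open>Countable additivity follows from continuity at the empty set: first fix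
  \<open>k\<close> with \<open>d k\<close> small, then let \<open>L k * measure Q (A i)\<close> tend
  to 0 for this \<open>k\<close>.\<close>

lemma charge_measure:
  assumes Q: "Q \<in> M1 X" and d: "d \<longlonglongrightarrow> 0" and p: "p \<in> charges X Q L d"
  shows "prob_space (charge_measure X p)"
    and "\<And>B. B \<in> sets (borel_of X) \<Longrightarrow> measure (charge_measure X p) B = p B"
proof -
  let ?S = "sets (borel_of X)"
  interpret Q: prob_space Q by (rule M1_D[OF Q])
  note sQ = M1_D(3,4)[OF Q]
  have nonneg: "0 \<le> p B" if "B \<in> ?S" for B
    using p that by (auto simp: charges_def PiE_iff)
  have add: "p (A \<union> B) = p A + p B" if "A \<in> ?S" "B \<in> ?S" "A \<inter> B = {}" for A B
    using p that by (auto simp: charges_def)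
  have dom: "p B \<le> L k * measure Q B + d k" if "B \<in> ?S" for B k
    using p that by (auto simp: charges_def)
  have p0: "p {} = 0" using add[of "{}" "{}"] by simp
  have "countably_additive ?S (\<lambda>B. ennreal (p B))"
  proof (rule ring_of_sets.empty_continuous_imp_countably_additive[of "topspace X"])
    show "ring_of_sets (topspace X) ?S"
      using sets.ring_of_sets_axioms[of "borel_of X"] by simp
    show "additive ?S (\<lambda>B. ennreal (p B))"
      by (auto simp: additive_def add nonneg simp flip: ennreal_plus)
    fix A :: "nat \<Rightarrow> 'a set"
    assume A: "range A \<subseteq> ?S" "decseq A" "(\<Inter>i. A i) = {}"
    then have AS: "A i \<in> ?S" for i by auto
    have Q0: "(\<lambda>i. measure Q (A i)) \<longlonglongrightarrow> 0"
      using Q.finite_Lim_measure_decseq[of A] A sQ by simp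
    have "(\<lambda>i. p (A i)) \<longlonglongrightarrow> 0"
    proof (rule tendstoI)
      fix e :: real assume e: "e > 0"
      obtain k where k: "\<bar>d k\<bar> < e/2"
        using LIMSEQ_D[OF d, of "e/2"] e by auto
      have "(\<lambda>i. L k * measure Q (A i)) \<longlonglongrightarrow> 0"
        using tendsto_mult_right_zero[OF Q0] by simp
      then have "\<forall>\<^sub>F i in sequentially. \<bar>L k * measure Q (A i)\<bar> < e/2"
        using e by (auto dest!: tendstoD[where e="e/2"])
      then show "\<forall>\<^sub>F i in sequentially. dist (p (A i)) 0 < e"
      proof (rule eventually_mono)
        fix i assume "\<bar>L k * measure Q (A i)\<bar> < e/2"
        then show "dist (p (A i)) 0 < e"
          using dom[OF AS, of i k] nonneg[OF AS, of i] k by simp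
      qed
    qed
    then show "(\<lambda>i. ennreal (p (A i))) \<longlonglongrightarrow> 0"
      using tendsto_ennrealI[of "\<lambda>i. p (A i)" 0 sequentially] by simp
  qed (auto simp: positive_def p0)
  then have eq: "emeasure (charge_measure X p) B = ennreal (p B)" if "B \<in> ?S" for B
    using that sets.sigma_algebra_axioms[of "borel_of X"] p0 unfolding charge_measure_def
    by (intro emeasure_measure_of_sigma) (auto simp: positive_def)
  show "measure (charge_measure X p) B = p B" if "B \<in> ?S" for B
    using eq[OF that] nonneg[OF that] by (simp add: measure_def)
  show "prob_space (charge_measure X p)"
    using eq[of "topspace X"] p sets.top[of "borel_of X"]
    by (intro prob_spaceI) (simp add: space_charge_measure charges_def)
qed

lemma charge_measure_dominated:
  assumes X: "Hausdorff_space X" and Q: "Q \<in> M1 X" and d: "d \<longlonglongrightarrow> 0" and p: "p \<in> charges X Q L d"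
  shows "charge_measure X p \<in> dominated_set X Q L d"
proof -
  have dom: "\<forall>B\<in>sets (borel_of X). measure (charge_measure X p) B \<le> L k * measure Q B + d k" for k
    using p charge_measure(2)[OF Q d p] by (simp add: charges_def)
  have "radon_prob X (charge_measure X p)"
  proof (rule radon_prob_dominated[OF X M1_D(1)[OF Q] charge_measure(1)[OF Q d p] sets_charge_measure])
    fix e :: real assume "e > 0"
    then obtain k where "\<bar>d k\<bar> < e" using LIMSEQ_D[OF d, of e] by auto
    then show "\<exists>L. \<forall>B\<in>sets (borel_of X). measure (charge_measure X p) B \<le> L * measure Q B + e"
      using dom[of k] by (intro exI[of _ "L k"]) force
  qed
  then show ?thesis using dom by (simp add: dominated_set_def M1_def)
qed

lemma dominated_set_eq_image:
  assumes X: "Hausdorff_space X" and Q: "Q \<in> M1 X" and d: "d \<longlonglongrightarrow> 0"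
  shows "dominated_set X Q L d = charge_measure X ` charges X Q L d"
proof
  show "charge_measure X ` charges X Q L d \<subseteq> dominated_set X Q L d"
    using charge_measure_dominated[OF assms] by blast
  show "dominated_set X Q L d \<subseteq> charge_measure X ` charges X Q L d"
  proof
    fix P assume P: "P \<in> dominated_set X Q L d"
    then have P1: "P \<in> M1 X" by (simp add: dominated_set_def)
    note P' = M1_D[OF P1]
    interpret prob_space P by (rule P')
    define p where "p = (\<lambda>B\<in>sets (borel_of X). measure P B)"
    have p: "p \<in> charges X Q L d"
      using P P' prob_space sets.top[of "borel_of X"]
      unfolding charges_def p_def dominated_set_def
      by (auto simp: finite_measure_Union)
    have "charge_measure X p = P"
    proof (rule measure_eqI)
      show "sets (charge_measure X p) = sets P" by (simp add: sets_charge_measure P')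
      fix B assume "B \<in> sets (charge_measure X p)"
      then have B: "B \<in> sets (borel_of X)" by (simp add: sets_charge_measure)
      interpret C: prob_space "charge_measure X p" by (rule charge_measure[OF Q d p])
      show "emeasure (charge_measure X p) B = emeasure P B"
        using charge_measure(2)[OF Q d p B] B
        unfolding C.emeasure_eq_measure emeasure_eq_measure by (simp add: p_def)
    qed
    then show "P \<in> charge_measure X ` charges X Q L d" using p by blast
  qed
qed

text \<open>A bounded Borel \<open>h\<close> is uniformly close to a step function, so its integral
  is close to a finite combination of coordinates, with an error that does not depend on the
  measure. Such combinations are continuous on the product.\<close>

lemma continuous_map_charge_measure:
  assumes X: "Hausdorff_space X" and Q: "Q \<in> M1 X" and d: "d \<longlonglongrightarrow> 0"
  shows "continuous_map (subtopology (powertop_real (sets (borel_of X))) (charges X Q L d))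
           (weak_top X) (charge_measure X)"
proof -
  let ?Z = "powertop_real (sets (borel_of X))"
  let ?T = "subtopology ?Z (charges X Q L d)"
  have topT: "topspace ?T = charges X Q L d"
    using compactin_subset_topspace[OF compactin_charges[of X Q L d]] by (simp add: Int_absorb1)
  have M1: "charge_measure X p \<in> M1 X" if "p \<in> charges X Q L d" for p
    using charge_measure_dominated[OF assms that] by (simp add: dominated_set_def)
  have pr: "continuous_map ?T euclideanreal (\<lambda>p. p B)" if "B \<in> sets (borel_of X)" for B
    using that by (intro continuous_map_from_subtopology continuous_map_product_projection)
  have op: "openin ?T {p \<in> charges X Q L d. (\<integral>x. h x \<partial>charge_measure X p) \<in> U}"
    if h: "h \<in> borel_measurable (borel_of X)" "bounded (h ` topspace X)" and U: "open U"
    for h :: "'a \<Rightarrow> real" and U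
  proof (subst openin_subopen, intro ballI)
    fix p0 assume "p0 \<in> {p \<in> charges X Q L d. (\<integral>x. h x \<partial>charge_measure X p) \<in> U}"
    then have p0: "p0 \<in> charges X Q L d" "(\<integral>x. h x \<partial>charge_measure X p0) \<in> U" by auto
    obtain e where e: "e > 0" "ball (\<integral>x. h x \<partial>charge_measure X p0) e \<subseteq> U"
      using U p0(2) openE by blast
    obtain I :: "int set" and c B where I: "finite I" "\<And>i. B i \<in> sets (borel_of X)"
      "\<And>x. x \<in> topspace X \<Longrightarrow> \<bar>h x - (\<Sum>i\<in>I. c i * indicator (B i) x)\<bar> \<le> e/3"
      using bounded_borel_simple_approx[OF h, of "e/3"] e by (metis divide_pos_pos zero_less_numeral)
    define f where "f p = (\<Sum>i\<in>I. c i * p (B i))" for p :: "'a set \<Rightarrow> real"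
    have f: "\<bar>(\<integral>x. h x \<partial>charge_measure X p) - f p\<bar> \<le> e/3" if "p \<in> charges X Q L d" for p
      using simple_approx_integral[OF M1[OF that] h I] charge_measure(2)[OF Q d that I(2)]
      by (simp add: f_def)
    have "continuous_map ?T euclideanreal f"
      unfolding f_def using I by (intro continuous_map_sum continuous_map_real_mult_left pr)
    then have "openin ?T {p \<in> topspace ?T. f p \<in> ball (f p0) (e/3)}"
      by (rule openin_continuous_map_preimage) auto
    then have "openin ?T {p \<in> charges X Q L d. f p \<in> ball (f p0) (e/3)}"
      by (simp only: topT)
    moreover have "(\<integral>x. h x \<partial>charge_measure X p) \<in> U"
      if "p \<in> charges X Q L d" "f p \<in> ball (f p0) (e/3)" for p
    proof -
      have "\<bar>f p0 - f p\<bar> < e/3" using that(2) by (simp add: dist_real_def)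
      then show ?thesis
        using f[OF that(1)] f[OF p0(1)] unfolding abs_le_iff abs_less_iff
        by (intro subsetD[OF e(2)]) (simp add: dist_real_def abs_less_iff)
    qed
    ultimately show "\<exists>V. openin ?T V \<and> p0 \<in> V \<and>
        V \<subseteq> {p \<in> charges X Q L d. (\<integral>x. h x \<partial>charge_measure X p) \<in> U}"
      using p0 e by (intro exI[of _ "{p \<in> charges X Q L d. f p \<in> ball (f p0) (e/3)}"]) auto
  qed
  show ?thesis
    unfolding weak_top_def
  proof (rule continuous_on_generated_topo)
    fix V assume "V \<in> {{P \<in> M1 X. (\<integral>x. h x \<partial>P) \<in> U} | (h :: 'a \<Rightarrow> real) U.
        h \<in> borel_measurable (borel_of X) \<and> bounded (h ` topspace X) \<and> open U}"
    then obtain h :: "'a \<Rightarrow> real" and U where V: "V = {P \<in> M1 X. (\<integral>x. h x \<partial>P) \<in> U}"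
      "h \<in> borel_measurable (borel_of X)" "bounded (h ` topspace X)" "open U" by blast
    have "charge_measure X -` V \<inter> topspace ?T
        = {p \<in> charges X Q L d. (\<integral>x. h x \<partial>charge_measure X p) \<in> U}"
      using M1 unfolding V(1) topT by auto
    then show "openin ?T (charge_measure X -` V \<inter> topspace ?T)" using op[OF V(2-4)] by simp
  next
    show "charge_measure X ` topspace ?T \<subseteq> \<Union> {{P \<in> M1 X. (\<integral>x. h x \<partial>P) \<in> U} | (h :: 'a \<Rightarrow> real) U.
        h \<in> borel_measurable (borel_of X) \<and> bounded (h ` topspace X) \<and> open U}"
      using M1 topspace_weak_top[of X] unfolding weak_top_def topology_generated_by_topspace topT
      by auto
  qed
qed

lemma compactin_dominated_set:
  assumes "Hausdorff_space X" "Q \<in> M1 X" "d \<longlonglongrightarrow> 0"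
  shows "compactin (weak_top X) (dominated_set X Q L d)"
proof -
  have "compactin (subtopology (powertop_real (sets (borel_of X))) (charges X Q L d)) (charges X Q L d)"
    using compactin_charges by (simp add: compactin_subtopology)
  from image_compactin[OF this continuous_map_charge_measure[OF assms]]
  show ?thesis unfolding dominated_set_eq_image[OF assms] .
qed

section \<open>Simplices and projections\<close>

lemma continuous_map_measurable:
  assumes "continuous_map S T f"
  shows "f \<in> borel_of S \<rightarrow>\<^sub>M borel_of T"
  unfolding borel_of_def[of T]
proof (rule measurable_measure_of)
  show "{U. openin T U} \<subseteq> Pow (topspace T)" by (auto dest: openin_subset)
  show "f \<in> space (borel_of S) \<rightarrow> topspace T"
    using assms by (simp add: continuous_map_def)
  fix U assume "U \<in> {U. openin T U}"
  then have "openin S {x \<in> topspace S. f x \<in> U}"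
    using assms by (simp add: openin_continuous_map_preimage)
  moreover have "f -` U \<inter> space (borel_of S) = {x \<in> topspace S. f x \<in> U}" by auto
  ultimately show "f -` U \<inter> space (borel_of S) \<in> sets (borel_of S)"
    using borel_of_openin by metis
qed

lemma topspace_prob_simplex_top [simp]: "topspace (prob_simplex_top \<alpha>) = prob_simplex \<alpha>"
  by (auto simp: prob_simplex_top_def prob_simplex_def)

lemma continuous_map_coord:
  "A \<in> \<alpha> \<Longrightarrow> continuous_map (prob_simplex_top \<alpha>) euclideanreal (\<lambda>p. p A)"
  unfolding prob_simplex_top_def
  by (intro continuous_map_from_subtopology continuous_map_product_projection)

lemma continuous_map_into_simplex:
  assumes "\<And>x. x \<in> topspace S \<Longrightarrow> f x \<in> prob_simplex \<alpha>"
    and "\<And>A. A \<in> \<alpha> \<Longrightarrow> continuous_map S euclideanreal (\<lambda>x. f x A)"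
  shows "continuous_map S (prob_simplex_top \<alpha>) f"
  unfolding prob_simplex_top_def continuous_map_in_subtopology continuous_map_componentwise
  using assms by (auto simp: prob_simplex_def PiE_iff)

text \<open>Serves to write open subsets of a simplex as increasing unions of closed ones.\<close>

lemma metrizable_prob_simplex_top: "finite \<alpha> \<Longrightarrow> metrizable_space (prob_simplex_top \<alpha>)"
  unfolding prob_simplex_top_def
  by (intro metrizable_space_subtopology)
    (auto simp: metrizable_space_product_topology metrizable_space_euclidean intro: countable_finite)

lemma borel_partitionD:
  assumes "borel_partition X \<alpha>"
  shows "finite \<alpha>" "\<And>A. A \<in> \<alpha> \<Longrightarrow> A \<in> sets (borel_of X)" "\<And>A. A \<in> \<alpha> \<Longrightarrow> A \<noteq> {}"
    "disjoint \<alpha>" "\<Union>\<alpha> = topspace X"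
  using assms by (auto simp: borel_partition_def)

lemma measure_disjoint_sum:
  assumes P: "P \<in> M1 X" and \<alpha>: "finite \<alpha>" "disjoint \<alpha>" "\<alpha> \<subseteq> sets (borel_of X)"
    and B: "B \<in> sets (borel_of X)"
  shows "measure P (\<Union>\<alpha> \<inter> B) = (\<Sum>A\<in>\<alpha>. measure P (A \<inter> B))"
proof -
  interpret prob_space P by (rule M1_D[OF P])
  have "measure P (\<Union>A\<in>\<alpha>. A \<inter> B) = (\<Sum>A\<in>\<alpha>. measure P (A \<inter> B))"
    using \<alpha> B M1_D[OF P]
    by (intro finite_measure_finite_Union) (auto simp: disjoint_family_on_def disjoint_def)
  then show ?thesis by (simp add: Int_commute)
qed

lemma measure_partition_sum:
  assumes "P \<in> M1 X" "borel_partition X \<alpha>" "B \<in> sets (borel_of X)"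
  shows "measure P B = (\<Sum>A\<in>\<alpha>. measure P (A \<inter> B))"
  using measure_disjoint_sum[OF assms(1) borel_partitionD(1,4)[OF assms(2)] _ assms(3)]
    borel_partitionD(2,5)[OF assms(2)] sets.sets_into_space[OF assms(3)]
  by (simp add: subset_eq[symmetric] subsetI Int_absorb1)

lemma proj_in_simplex:
  assumes P: "P \<in> M1 X" and \<alpha>: "borel_partition X \<alpha>"
  shows "proj \<alpha> P \<in> prob_simplex \<alpha>"
proof -
  interpret prob_space P by (rule M1_D[OF P])
  have "(\<Sum>A\<in>\<alpha>. measure P A) = measure P (topspace X)"
  proof -
    have "A \<inter> topspace X = A" if "A \<in> \<alpha>" for A using borel_partitionD(5)[OF \<alpha>] that by blast
    then show ?thesis
      using measure_partition_sum[OF P \<alpha>, of "topspace X"] sets.top[of "borel_of X"] by simp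
  qed
  then show ?thesis
    using prob_space M1_D(4)[OF P] by (auto simp: prob_simplex_def proj_def)
qed

lemma continuous_map_proj:
  assumes \<alpha>: "borel_partition X \<alpha>"
  shows "continuous_map (weak_top X) (prob_simplex_top \<alpha>) (proj \<alpha>)"
proof (rule continuous_map_into_simplex)
  fix A assume A: "A \<in> \<alpha>"
  then show "continuous_map (weak_top X) euclideanreal (\<lambda>P. proj \<alpha> P A)"
    using continuous_map_measure[OF borel_partitionD(2)[OF \<alpha> A]] by (simp add: proj_def)
qed (simp add: proj_in_simplex[OF _ \<alpha>])

section \<open>Transition maps between simplices\<close>

lemma refines_Union:
  assumes \<alpha>: "borel_partition X \<alpha>" and \<beta>: "borel_partition X \<beta>" and r: "refines \<alpha> \<beta>" and A: "A \<in> \<alpha>"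
  shows "\<Union>{B\<in>\<beta>. B \<subseteq> A} = A"
proof
  show "A \<subseteq> \<Union>{B\<in>\<beta>. B \<subseteq> A}"
  proof
    fix x assume x: "x \<in> A"
    then have "x \<in> \<Union>\<beta>" using A borel_partitionD(5)[OF \<alpha>] borel_partitionD(5)[OF \<beta>] by blast
    then obtain B where B: "B \<in> \<beta>" "x \<in> B" by blast
    then obtain A' where A': "A' \<in> \<alpha>" "B \<subseteq> A'" using r by (auto simp: refines_def)
    then have "A' = A" using borel_partitionD(4)[OF \<alpha>] A x B by (auto simp: disjoint_def)
    then show "x \<in> \<Union>{B\<in>\<beta>. B \<subseteq> A}" using A' B by blast
  qed
qed blast

lemma trans_map_proj:
  assumes \<alpha>: "borel_partition X \<alpha>" and \<beta>: "borel_partition X \<beta>" and r: "refines \<alpha> \<beta>"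
    and P: "P \<in> M1 X"
  shows "trans_map \<alpha> \<beta> (proj \<beta> P) = proj \<alpha> P"
proof -
  have "(\<Sum>B\<in>{B\<in>\<beta>. B \<subseteq> A}. measure P B) = measure P A" if A: "A \<in> \<alpha>" for A
  proof -
    have "disjoint {B\<in>\<beta>. B \<subseteq> A}" using borel_partitionD(4)[OF \<beta>] by (auto simp: disjoint_def)
    then have "measure P (\<Union>{B\<in>\<beta>. B \<subseteq> A} \<inter> topspace X)
        = (\<Sum>B\<in>{B\<in>\<beta>. B \<subseteq> A}. measure P (B \<inter> topspace X))"
      using borel_partitionD(1,2)[OF \<beta>] sets.top[of "borel_of X"]
      by (intro measure_disjoint_sum[OF P]) auto
    moreover have "B \<inter> topspace X = B" if "B \<in> \<beta>" for B
      using borel_partitionD(5)[OF \<beta>] that by blast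
    moreover have "A \<inter> topspace X = A" using borel_partitionD(5)[OF \<alpha>] A by blast
    ultimately show ?thesis unfolding refines_Union[OF \<alpha> \<beta> r A] by simp
  qed
  then show ?thesis by (auto simp: trans_map_def proj_def fun_eq_iff intro!: sum.cong)
qed

lemma trans_map_in_simplex:
  assumes \<alpha>: "borel_partition X \<alpha>" and \<beta>: "borel_partition X \<beta>" and r: "refines \<alpha> \<beta>"
    and p: "p \<in> prob_simplex \<beta>"
  shows "trans_map \<alpha> \<beta> p \<in> prob_simplex \<alpha>"
proof -
  have "(\<Sum>A\<in>\<alpha>. \<Sum>B\<in>{B\<in>\<beta>. B \<subseteq> A}. p B) = (\<Sum>B\<in>(\<Union>A\<in>\<alpha>. {B\<in>\<beta>. B \<subseteq> A}). p B)"
  proof (rule sum.UNION_disjoint[symmetric])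
    \<comment> \<open>Non-emptiness of cells matters: an empty member of \<open>\<beta>\<close>
      would lie in every \<open>A\<close> and be counted repeatedly.\<close>
    show "\<forall>A\<in>\<alpha>. \<forall>A'\<in>\<alpha>. A \<noteq> A' \<longrightarrow> {B\<in>\<beta>. B \<subseteq> A} \<inter> {B\<in>\<beta>. B \<subseteq> A'} = {}"
    proof (intro ballI impI equals0I)
      fix A A' B assume A: "A \<in> \<alpha>" "A' \<in> \<alpha>" "A \<noteq> A'"
        and "B \<in> {B\<in>\<beta>. B \<subseteq> A} \<inter> {B\<in>\<beta>. B \<subseteq> A'}"
      then have B: "B \<in> \<beta>" "B \<subseteq> A \<inter> A'" by auto
      have "A \<inter> A' = {}" using borel_partitionD(4)[OF \<alpha>] A by (auto simp: disjoint_def)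
      then show False using B borel_partitionD(3)[OF \<beta>] by blast
    qed
  qed (use borel_partitionD(1)[OF \<alpha>] borel_partitionD(1)[OF \<beta>] in auto)
  also have "(\<Union>A\<in>\<alpha>. {B\<in>\<beta>. B \<subseteq> A}) = \<beta>" using r by (auto simp: refines_def)
  finally show ?thesis
    using p by (auto simp: prob_simplex_def trans_map_def intro!: sum_nonneg)
qed

lemma continuous_map_trans_map:
  assumes \<alpha>: "borel_partition X \<alpha>" and \<beta>: "borel_partition X \<beta>" and r: "refines \<alpha> \<beta>"
  shows "continuous_map (prob_simplex_top \<beta>) (prob_simplex_top \<alpha>) (trans_map \<alpha> \<beta>)"
proof (rule continuous_map_into_simplex)
  fix A assume "A \<in> \<alpha>"
  then show "continuous_map (prob_simplex_top \<beta>) euclideanreal (\<lambda>p. trans_map \<alpha> \<beta> p A)"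
    using borel_partitionD(1)[OF \<beta>]
    by (auto simp: trans_map_def intro!: continuous_map_sum continuous_map_coord)
qed (simp add: trans_map_in_simplex[OF assms])

text \<open>Each summand is the positive part of \<open>p A - L * measure Q A\<close>.\<close>

definition excess :: "'a measure \<Rightarrow> 'a set set \<Rightarrow> real \<Rightarrow> ('a set \<Rightarrow> real) \<Rightarrow> real" where
  "excess Q \<alpha> L p = (\<Sum>A\<in>\<alpha>. \<bar>p A - min (p A) (L * measure Q A)\<bar>)"

lemma continuous_map_excess:
  assumes "finite \<alpha>"
  shows "continuous_map (prob_simplex_top \<alpha>) euclideanreal (excess Q \<alpha> L)"
  unfolding excess_def using assms
  by (intro continuous_map_sum continuous_map_real_abs continuous_map_diff continuous_map_real_min
      continuous_map_coord) auto

text \<open>Since \<open>x / 0 = 0\<close>, mass on a \<open>Q\<close>-null cell is lost; hence the side condition on such cells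
  in the lemmas making \<open>spread\<close> a section of the projection.\<close>

definition spread :: "'a measure \<Rightarrow> 'a set set \<Rightarrow> ('a set \<Rightarrow> real) \<Rightarrow> 'a measure" where
  "spread Q \<alpha> p = density Q (\<lambda>x. \<Sum>A\<in>\<alpha>. ennreal (p A / measure Q A) * indicator A x)"

lemma emeasure_spread:
  assumes Q: "Q \<in> M1 X" and \<alpha>: "borel_partition X \<alpha>" and p: "p \<in> prob_simplex \<alpha>"
    and B: "B \<in> sets (borel_of X)"
  shows "emeasure (spread Q \<alpha> p) B = ennreal (\<Sum>A\<in>\<alpha>. p A / measure Q A * measure Q (A \<inter> B))"
proof -
  interpret Q: prob_space Q by (rule M1_D[OF Q])
  have sA [measurable]: "A \<in> sets Q" if "A \<in> \<alpha>" for A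
    using borel_partitionD(2)[OF \<alpha> that] M1_D(3)[OF Q] by simp
  have sB [measurable]: "B \<in> sets Q" using B M1_D(3)[OF Q] by simp
  have nn: "0 \<le> p A" if "A \<in> \<alpha>" for A using p that by (simp add: prob_simplex_def)
  have "emeasure (spread Q \<alpha> p) B
      = (\<integral>\<^sup>+x. (\<Sum>A\<in>\<alpha>. ennreal (p A / measure Q A) * indicator A x) * indicator B x \<partial>Q)"
    unfolding spread_def by (intro emeasure_density borel_measurable_sum) auto
  also have "\<dots> = (\<integral>\<^sup>+x. (\<Sum>A\<in>\<alpha>. ennreal (p A / measure Q A) * indicator (A \<inter> B) x) \<partial>Q)"
    by (simp add: sum_distrib_right mult.assoc indicator_inter_arith)
  also have "\<dots> = (\<Sum>A\<in>\<alpha>. \<integral>\<^sup>+x. ennreal (p A / measure Q A) * indicator (A \<inter> B) x \<partial>Q)"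
    by (intro nn_integral_sum) auto
  also have "\<dots> = (\<Sum>A\<in>\<alpha>. ennreal (p A / measure Q A * measure Q (A \<inter> B)))"
    by (intro sum.cong refl) (simp add: nn_integral_cmult Q.emeasure_eq_measure ennreal_mult nn
        del: times_divide_eq_left)
  also have "\<dots> = ennreal (\<Sum>A\<in>\<alpha>. p A / measure Q A * measure Q (A \<inter> B))"
    by (intro sum_ennreal) (simp add: nn)
  finally show ?thesis .
qed

text \<open>Within a cell the mass \<open>p A \<le> L * measure Q A + r\<close> is distributed
  proportionally to \<open>Q\<close>, so a subset of the cell gets at most \<open>L\<close> times
  its \<open>Q\<close>-mass plus a fraction of \<open>r\<close>. Bounds known on cells thus extend
  to all Borel sets, with the same \<open>L\<close> and the total excess as error.\<close>

lemma spread: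
  assumes X: "Hausdorff_space X" and Q: "Q \<in> M1 X" and \<alpha>: "borel_partition X \<alpha>"
    and p: "p \<in> prob_simplex \<alpha>" and null: "\<And>A. A \<in> \<alpha> \<Longrightarrow> measure Q A = 0 \<Longrightarrow> p A = 0"
  shows spread_in_M1: "spread Q \<alpha> p \<in> M1 X"
    and proj_spread: "proj \<alpha> (spread Q \<alpha> p) = p"
    and spread_le: "\<And>B L. B \<in> sets (borel_of X) \<Longrightarrow> L \<ge> 0 \<Longrightarrow>
      measure (spread Q \<alpha> p) B \<le> L * measure Q B + excess Q \<alpha> L p"
proof -
  interpret Q: prob_space Q by (rule M1_D[OF Q])
  have sA: "A \<in> sets Q" if "A \<in> \<alpha>" for A
    using borel_partitionD(2)[OF \<alpha> that] M1_D(3)[OF Q] by simp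
  have nn: "0 \<le> p A" if "A \<in> \<alpha>" for A using p that by (simp add: prob_simplex_def)
  have m: "measure (spread Q \<alpha> p) B = (\<Sum>A\<in>\<alpha>. p A / measure Q A * measure Q (A \<inter> B))"
    if "B \<in> sets (borel_of X)" for B
    using emeasure_spread[OF Q \<alpha> p that] by (simp add: measure_def sum_nonneg nn)
  have sets: "sets (spread Q \<alpha> p) = sets (borel_of X)"
    using M1_D(3)[OF Q] by (simp add: spread_def)
  have space: "space (spread Q \<alpha> p) = topspace X"
    using M1_D(4)[OF Q] by (simp add: spread_def)
  have cell: "(\<Sum>A\<in>\<alpha>. p A / measure Q A * measure Q (A \<inter> topspace X)) = 1"
  proof -
    have "p A / measure Q A * measure Q (A \<inter> topspace X) = p A" if "A \<in> \<alpha>" for A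
    proof -
      have "A \<inter> topspace X = A" using borel_partitionD(5)[OF \<alpha>] that by blast
      then show ?thesis using null[OF that] by simp
    qed
    then show ?thesis using p by (simp add: prob_simplex_def)
  qed
  have prob: "prob_space (spread Q \<alpha> p)"
    using emeasure_spread[OF Q \<alpha> p, of "topspace X"] cell sets.top[of "borel_of X"]
    by (intro prob_spaceI) (simp add: space)
  show le: "measure (spread Q \<alpha> p) B \<le> L * measure Q B + excess Q \<alpha> L p"
    if B: "B \<in> sets (borel_of X)" and L: "L \<ge> 0" for B L
  proof -
    have "p A / measure Q A * measure Q (A \<inter> B)
        \<le> L * measure Q (A \<inter> B) + \<bar>p A - min (p A) (L * measure Q A)\<bar>" if A: "A \<in> \<alpha>" for A
    proof (cases "measure Q A = 0")
      case False
      then have q: "measure Q A > 0" by (simp add: zero_less_measure_iff)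
      have t: "measure Q (A \<inter> B) \<le> measure Q A" by (intro Q.finite_measure_mono sA A) auto
      define r where "r = p A - min (p A) (L * measure Q A)"
      have r: "r \<ge> 0" "p A \<le> L * measure Q A + r" by (auto simp: r_def)
      have "p A / measure Q A * measure Q (A \<inter> B)
          \<le> (L * measure Q A + r) / measure Q A * measure Q (A \<inter> B)"
        using r q by (intro mult_right_mono divide_right_mono) auto
      also have "\<dots> = L * measure Q (A \<inter> B) + r * (measure Q (A \<inter> B) / measure Q A)"
        using q by (simp add: field_simps)
      also have "r * (measure Q (A \<inter> B) / measure Q A) \<le> r"
        using r t q by (intro mult_left_le) auto
      finally show ?thesis using r by (simp add: r_def)
    qed (use L in simp)
    then have "measure (spread Q \<alpha> p) B
        \<le> (\<Sum>A\<in>\<alpha>. L * measure Q (A \<inter> B) + \<bar>p A - min (p A) (L * measure Q A)\<bar>)"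
      unfolding m[OF B] by (intro sum_mono)
    also have "\<dots> = L * measure Q B + excess Q \<alpha> L p"
      by (simp only: sum.distrib measure_partition_sum[OF Q \<alpha> B] sum_distrib_left excess_def)
    finally show ?thesis .
  qed
  have "radon_prob X (spread Q \<alpha> p)"
  proof (rule radon_prob_dominated[OF X M1_D(1)[OF Q] prob sets])
    fix e :: real assume e: "e > 0"
    \<comment> \<open>The sum of the cell densities is at least each of them, so with this
      \<open>L\<close> the excess vanishes and \<open>le\<close> becomes domination by a multiple of
      \<open>Q\<close>.\<close>
    define L where "L = (\<Sum>A\<in>\<alpha>. p A / measure Q A)"
    have "excess Q \<alpha> L p = 0"
      unfolding excess_def
    proof (intro sum.neutral ballI)
      fix A assume A: "A \<in> \<alpha>"
      have "p A \<le> L * measure Q A"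
      proof (cases "measure Q A = 0")
        case False
        have "p A / measure Q A \<le> L"
          unfolding L_def using A borel_partitionD(1)[OF \<alpha>] nn
          by (intro member_le_sum) auto
        then show ?thesis
          using False by (simp add: pos_divide_le_eq zero_less_measure_iff)
      qed (use null[OF A] in simp)
      then show "\<bar>p A - min (p A) (L * measure Q A)\<bar> = 0" by simp
    qed
    moreover have "L \<ge> 0" unfolding L_def using nn by (intro sum_nonneg) simp
    ultimately show "\<exists>L. \<forall>B\<in>sets (borel_of X). measure (spread Q \<alpha> p) B \<le> L * measure Q B + e"
      using le[of _ L] e by (intro exI[of _ L]) force
  qed
  then show "spread Q \<alpha> p \<in> M1 X" by (simp add: M1_def)
  show "proj \<alpha> (spread Q \<alpha> p) = p"
  proof
    fix A show "proj \<alpha> (spread Q \<alpha> p) A = p A"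
    proof (cases "A \<in> \<alpha>")
      case True
      have "p A' / measure Q A' * measure Q (A' \<inter> A) = (if A' = A then p A else 0)"
        if A': "A' \<in> \<alpha>" for A'
      proof (cases "A' = A")
        case False
        then have "A' \<inter> A = {}" using borel_partitionD(4)[OF \<alpha>] A' True by (auto simp: disjoint_def)
        then show ?thesis using False by simp
      qed (use null[OF True] in simp)
      then have "measure (spread Q \<alpha> p) A = p A"
        using m[OF borel_partitionD(2)[OF \<alpha> True]] True borel_partitionD(1)[OF \<alpha>]
        by (simp add: sum.delta)
      then show ?thesis using True by (simp add: proj_def)
    next
      case False
      then show ?thesis using p by (auto simp: proj_def prob_simplex_def)
    qed
  qed
qed

section \<open>Cylinder sets\<close>

locale partition_system =
  fixes X :: "'a topology" and \<A> :: "'a set set set"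
    and Pis :: "'a set set \<Rightarrow> ('a set \<Rightarrow> real) measure"
  assumes Hausdorff_X: "Hausdorff_space X"
    and Hausdorff_weak: "Hausdorff_space (weak_top X)"
    and partition: "\<alpha> \<in> \<A> \<Longrightarrow> borel_partition X \<alpha>"
    and directed: "directed_partitions \<A>"
    and resolves: "resolves X \<A>"
    and sets_Pis: "\<alpha> \<in> \<A> \<Longrightarrow> sets (Pis \<alpha>) = sets (borel_of (prob_simplex_top \<alpha>))"
    and prob_space_Pis: "\<alpha> \<in> \<A> \<Longrightarrow> prob_space (Pis \<alpha>)"
    and coherent: "coherent \<A> Pis"
begin

lemma space_Pis: "\<alpha> \<in> \<A> \<Longrightarrow> space (Pis \<alpha>) = prob_simplex \<alpha>"
  using sets_eq_imp_space_eq[OF sets_Pis] by simp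

lemma common_refinement:
  assumes "\<alpha> \<in> \<A>" "\<beta> \<in> \<A>"
  obtains \<gamma> where "\<gamma> \<in> \<A>" "refines \<alpha> \<gamma>" "refines \<beta> \<gamma>"
  using directed assms unfolding directed_partitions_def by blast

text \<open>Moves the base of a cylinder to a finer partition; by \<open>cyl_pull\<close> and
  \<open>measure_pull\<close> neither the cylinder nor the mass changes.\<close>

definition pull :: "'a set set \<Rightarrow> 'a set set \<Rightarrow> ('a set \<Rightarrow> real) set \<Rightarrow> ('a set \<Rightarrow> real) set" where
  "pull \<alpha> \<beta> W = {p \<in> prob_simplex \<beta>. trans_map \<alpha> \<beta> p \<in> W}"

lemma
  assumes \<alpha>: "\<alpha> \<in> \<A>" and \<beta>: "\<beta> \<in> \<A>" and r: "refines \<alpha> \<beta>"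
    and W: "W \<in> sets (borel_of (prob_simplex_top \<alpha>))"
  shows sets_pull: "pull \<alpha> \<beta> W \<in> sets (borel_of (prob_simplex_top \<beta>))"
    and measure_pull: "measure (Pis \<beta>) (pull \<alpha> \<beta> W) = measure (Pis \<alpha>) W"
proof -
  have t: "trans_map \<alpha> \<beta> \<in> borel_of (prob_simplex_top \<beta>) \<rightarrow>\<^sub>M borel_of (prob_simplex_top \<alpha>)"
    by (intro continuous_map_measurable continuous_map_trans_map[OF partition[OF \<alpha>] partition[OF \<beta>] r])
  have eq: "pull \<alpha> \<beta> W = trans_map \<alpha> \<beta> -` W \<inter> space (borel_of (prob_simplex_top \<beta>))"
    by (auto simp: pull_def)
  show "pull \<alpha> \<beta> W \<in> sets (borel_of (prob_simplex_top \<beta>))"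
    unfolding eq by (rule measurable_sets[OF t W])
  have "measure (Pis \<alpha>) W
      = measure (distr (Pis \<beta>) (borel_of (prob_simplex_top \<alpha>)) (trans_map \<alpha> \<beta>)) W"
    using coherent \<alpha> \<beta> r unfolding coherent_def by metis
  also have "\<dots> = measure (Pis \<beta>) (trans_map \<alpha> \<beta> -` W \<inter> space (Pis \<beta>))"
    using t W measurable_cong_sets[OF sets_Pis[OF \<beta>] refl] by (intro measure_distr) auto
  finally show "measure (Pis \<beta>) (pull \<alpha> \<beta> W) = measure (Pis \<alpha>) W"
    unfolding eq by (simp add: space_Pis[OF \<beta>])
qed

lemma openin_pull:
  assumes "\<alpha> \<in> \<A>" "\<beta> \<in> \<A>" "refines \<alpha> \<beta>" "openin (prob_simplex_top \<alpha>) W"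
  shows "openin (prob_simplex_top \<beta>) (pull \<alpha> \<beta> W)"
  using openin_continuous_map_preimage[OF continuous_map_trans_map[of X \<alpha> \<beta>] assms(4)] assms partition
  by (simp add: pull_def)

definition cyl :: "'a set set \<Rightarrow> ('a set \<Rightarrow> real) set \<Rightarrow> 'a measure set" where
  "cyl \<alpha> W = {P \<in> M1 X. proj \<alpha> P \<in> W}"

lemma cyl_pull:
  "\<alpha> \<in> \<A> \<Longrightarrow> \<beta> \<in> \<A> \<Longrightarrow> refines \<alpha> \<beta> \<Longrightarrow> cyl \<beta> (pull \<alpha> \<beta> W) = cyl \<alpha> W"
  by (auto simp: cyl_def pull_def trans_map_proj[OF partition partition] proj_in_simplex[OF _ partition])

lemma cyl_Un: "cyl \<alpha> (V \<union> W) = cyl \<alpha> V \<union> cyl \<alpha> W"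
  and cyl_Int: "cyl \<alpha> (V \<inter> W) = cyl \<alpha> V \<inter> cyl \<alpha> W"
  and cyl_Diff: "cyl \<alpha> (V - W) = cyl \<alpha> V - cyl \<alpha> W"
  and cyl_empty: "cyl \<alpha> {} = {}"
  by (auto simp: cyl_def)

lemma cyl_simplex: "\<alpha> \<in> \<A> \<Longrightarrow> cyl \<alpha> (prob_simplex \<alpha>) = M1 X"
  by (auto simp: cyl_def proj_in_simplex[OF _ partition])

lemma openin_cyl:
  "\<alpha> \<in> \<A> \<Longrightarrow> openin (prob_simplex_top \<alpha>) W \<Longrightarrow> openin (weak_top X) (cyl \<alpha> W)"
  using openin_continuous_map_preimage[OF continuous_map_proj[OF partition], of \<alpha> W]
  by (simp add: cyl_def)

lemma measure_cyl:
  assumes M: "radon_prob (weak_top X) M" and \<alpha>: "\<alpha> \<in> \<A>"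
    and W: "W \<in> sets (borel_of (prob_simplex_top \<alpha>))"
  shows "measure (distr M (borel_of (prob_simplex_top \<alpha>)) (proj \<alpha>)) W = measure M (cyl \<alpha> W)"
proof -
  have "proj \<alpha> \<in> M \<rightarrow>\<^sub>M borel_of (prob_simplex_top \<alpha>)"
    using continuous_map_measurable[OF continuous_map_proj[OF partition[OF \<alpha>]]]
      measurable_cong_sets[OF radon_probD(1)[OF M] refl] by blast
  then have "measure (distr M (borel_of (prob_simplex_top \<alpha>)) (proj \<alpha>)) W
      = measure M (proj \<alpha> -` W \<inter> space M)"
    using W by (intro measure_distr) auto
  moreover have "proj \<alpha> -` W \<inter> space M = cyl \<alpha> W"
    using radon_probD(3)[OF M] by (auto simp: cyl_def)
  ultimately show ?thesis by simp
qed

section \<open>The lattice of open cylinders and the algebra of Borel cylinders\<close>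

definition open_cyls :: "'a measure set set" where
  "open_cyls = (\<Union>\<alpha>\<in>\<A>. cyl \<alpha> ` {W. openin (prob_simplex_top \<alpha>) W})"

definition borel_cyls :: "'a measure set set" where
  "borel_cyls = (\<Union>\<alpha>\<in>\<A>. cyl \<alpha> ` sets (borel_of (prob_simplex_top \<alpha>)))"

lemma open_cylsI: "\<alpha> \<in> \<A> \<Longrightarrow> openin (prob_simplex_top \<alpha>) W \<Longrightarrow> cyl \<alpha> W \<in> open_cyls"
  by (auto simp: open_cyls_def)

lemma borel_cylsI: "\<alpha> \<in> \<A> \<Longrightarrow> W \<in> sets (borel_of (prob_simplex_top \<alpha>)) \<Longrightarrow> cyl \<alpha> W \<in> borel_cyls"
  by (auto simp: borel_cyls_def)

lemma open_cyls2:
  assumes "U \<in> open_cyls" "V \<in> open_cyls"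
  obtains \<gamma> W W' where "\<gamma> \<in> \<A>" "openin (prob_simplex_top \<gamma>) W" "openin (prob_simplex_top \<gamma>) W'"
    "U = cyl \<gamma> W" "V = cyl \<gamma> W'"
proof -
  obtain \<alpha> \<beta> W W' where *: "\<alpha> \<in> \<A>" "openin (prob_simplex_top \<alpha>) W" "U = cyl \<alpha> W"
    "\<beta> \<in> \<A>" "openin (prob_simplex_top \<beta>) W'" "V = cyl \<beta> W'"
    using assms by (auto simp: open_cyls_def)
  obtain \<gamma> where "\<gamma> \<in> \<A>" "refines \<alpha> \<gamma>" "refines \<beta> \<gamma>" using common_refinement * by metis
  then show thesis
    using * by (intro that[of \<gamma> "pull \<alpha> \<gamma> W" "pull \<beta> \<gamma> W'"]) (simp_all add: openin_pull cyl_pull)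
qed

lemma borel_cyls2:
  assumes "U \<in> borel_cyls" "V \<in> borel_cyls"
  obtains \<gamma> W W' where "\<gamma> \<in> \<A>" "W \<in> sets (borel_of (prob_simplex_top \<gamma>))"
    "W' \<in> sets (borel_of (prob_simplex_top \<gamma>))" "U = cyl \<gamma> W" "V = cyl \<gamma> W'"
proof -
  obtain \<alpha> \<beta> W W' where *: "\<alpha> \<in> \<A>" "W \<in> sets (borel_of (prob_simplex_top \<alpha>))" "U = cyl \<alpha> W"
    "\<beta> \<in> \<A>" "W' \<in> sets (borel_of (prob_simplex_top \<beta>))" "V = cyl \<beta> W'"
    using assms by (auto simp: borel_cyls_def)
  obtain \<gamma> where "\<gamma> \<in> \<A>" "refines \<alpha> \<gamma>" "refines \<beta> \<gamma>" using common_refinement * by metis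
  then show thesis
    using * by (intro that[of \<gamma> "pull \<alpha> \<gamma> W" "pull \<beta> \<gamma> W'"]) (simp_all add: sets_pull cyl_pull)
qed

text \<open>Cells alone are in general not closed under intersection: cells of two partitions meet
  in a union of cells of a common refinement. Unions of cells of one partition form an
  intersection-stable generator, and \<open>\<A> \<noteq> {}\<close> puts the whole space into
  it.\<close>

lemma measure_eq_on_partitions_imp_eq:
  assumes ne: "\<A> \<noteq> {}" and P: "P \<in> M1 X" "P' \<in> M1 X"
    and eq: "\<And>\<alpha> A. \<alpha> \<in> \<A> \<Longrightarrow> A \<in> \<alpha> \<Longrightarrow> measure P A = measure P' A"
  shows "P = P'"
proof -
  define E where "E = (\<Union>\<alpha>\<in>\<A>. Union ` Pow \<alpha>)"
  have EI: "\<Union>S \<in> E" if "S \<subseteq> \<alpha>" "\<alpha> \<in> \<A>" for S \<alpha>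
    using that by (auto simp: E_def)
  interpret P: prob_space P by (rule M1_D[OF P(1)])
  interpret P': prob_space P' by (rule M1_D[OF P(2)])
  have Es: "E \<subseteq> sets (borel_of X)"
  proof
    fix e assume "e \<in> E"
    then obtain S \<alpha> where S: "\<alpha> \<in> \<A>" "S \<subseteq> \<alpha>" "e = \<Union>S" by (auto simp: E_def)
    have "finite S" using borel_partitionD(1)[OF partition[OF S(1)]] S(2) finite_subset by blast
    then show "e \<in> sets (borel_of X)"
      using S borel_partitionD(2)[OF partition[OF S(1)]] by (auto intro!: sets.finite_Union)
  qed
  have "\<Union>\<A> \<subseteq> E" using EI[of "{A}" for A] by fastforce
  then have gen: "sets (borel_of X) = sigma_sets (topspace X) E"
    using resolves Es sets.sigma_sets_subset[of E "borel_of X"] sigma_sets_subseteq[of "\<Union>\<A>" E "topspace X"]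
    by (auto simp: resolves_def)
  obtain \<alpha>0 where \<alpha>0: "\<alpha>0 \<in> \<A>" using ne by blast
  have top: "topspace X \<in> E"
    using EI[OF order_refl \<alpha>0] borel_partitionD(5)[OF partition[OF \<alpha>0]] by simp
  show ?thesis
  proof (rule measure_eqI_generator_eq[where E=E and \<Omega>="topspace X" and A="\<lambda>_. topspace X"])
    show "Int_stable E"
    proof (rule Int_stableI)
      fix a b assume "a \<in> E" "b \<in> E"
      then obtain S T \<alpha> \<beta> where ST: "\<alpha> \<in> \<A>" "S \<subseteq> \<alpha>" "a = \<Union>S" "\<beta> \<in> \<A>" "T \<subseteq> \<beta>" "b = \<Union>T"
        by (auto simp: E_def)
      obtain \<gamma> where \<gamma>: "\<gamma> \<in> \<A>" "refines \<alpha> \<gamma>" "refines \<beta> \<gamma>" using common_refinement ST by metis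
      have "a \<inter> b \<subseteq> \<Union>{C\<in>\<gamma>. C \<subseteq> a \<inter> b}"
      proof
        fix x assume x: "x \<in> a \<inter> b"
        then obtain A B where AB: "A \<in> S" "x \<in> A" "B \<in> T" "x \<in> B" using ST by blast
        have "A \<in> \<alpha>" "B \<in> \<beta>" using AB ST by auto
        then have "x \<in> \<Union>{C\<in>\<gamma>. C \<subseteq> A}" "x \<in> \<Union>{C\<in>\<gamma>. C \<subseteq> B}"
          using AB refines_Union[OF partition[OF ST(1)] partition[OF \<gamma>(1)] \<gamma>(2)]
            refines_Union[OF partition[OF ST(4)] partition[OF \<gamma>(1)] \<gamma>(3)] by simp_all
        then obtain C C' where C: "C \<in> \<gamma>" "C \<subseteq> A" "x \<in> C" "C' \<in> \<gamma>" "C' \<subseteq> B" "x \<in> C'" by blast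
        then have "C = C'"
          using borel_partitionD(4)[OF partition[OF \<gamma>(1)]] unfolding disjoint_def by blast
        then show "x \<in> \<Union>{C\<in>\<gamma>. C \<subseteq> a \<inter> b}" using C AB ST by blast
      qed
      then have "\<Union>{C\<in>\<gamma>. C \<subseteq> a \<inter> b} = a \<inter> b" by blast
      moreover have "\<Union>{C\<in>\<gamma>. C \<subseteq> a \<inter> b} \<in> E" by (rule EI[OF Collect_restrict \<gamma>(1)])
      ultimately show "a \<inter> b \<in> E" by (simp only:)
    qed
    show "emeasure P e = emeasure P' e" if e: "e \<in> E" for e
    proof -
      obtain S \<alpha> where S: "\<alpha> \<in> \<A>" "S \<subseteq> \<alpha>" "e = \<Union>S" using e by (auto simp: E_def)
      note \<alpha> = borel_partitionD[OF partition[OF S(1)]]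
      have S': "finite S" "disjoint S" "S \<subseteq> sets (borel_of X)"
        using finite_subset[OF S(2) \<alpha>(1)] \<alpha>(2,4) S(2) by (auto simp: disjoint_def)
      have "A \<inter> topspace X = A" if "A \<in> S" for A using \<alpha>(5) S(2) that by blast
      moreover have "\<Union>S \<inter> topspace X = \<Union>S" using \<alpha>(5) S(2) by blast
      moreover have "(\<Sum>A\<in>S. measure P A) = (\<Sum>A\<in>S. measure P' A)"
        using eq S by (intro sum.cong) auto
      ultimately have "measure P e = measure P' e"
        using measure_disjoint_sum[OF P(1) S', of "topspace X"]
          measure_disjoint_sum[OF P(2) S', of "topspace X"] sets.top[of "borel_of X"] S(3) by simp
      then show ?thesis by (simp add: P.emeasure_eq_measure P'.emeasure_eq_measure)
    qed
    show "E \<subseteq> Pow (topspace X)" using Es sets.space_closed[of "borel_of X"] by auto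
    show "sets P = sigma_sets (topspace X) E" "sets P' = sigma_sets (topspace X) E"
      using M1_D(3)[OF P(1)] M1_D(3)[OF P(2)] gen by auto
  qed (use top P.emeasure_finite in auto)
qed

lemma separating_family_open_cyls:
  assumes ne: "\<A> \<noteq> {}"
  shows "separating_family (weak_top X) open_cyls"
proof
  obtain \<alpha>0 where \<alpha>0: "\<alpha>0 \<in> \<A>" using ne by blast
  show "{} \<in> open_cyls" using open_cylsI[OF \<alpha>0, of "{}"] by (simp add: cyl_empty)
  show "topspace (weak_top X) \<in> open_cyls"
    using open_cylsI[OF \<alpha>0 openin_topspace] by (simp add: cyl_simplex[OF \<alpha>0])
  show "openin (weak_top X) U" if "U \<in> open_cyls" for U
    using that openin_cyl by (auto simp: open_cyls_def)
  show "U \<union> V \<in> open_cyls" if UV: "U \<in> open_cyls" "V \<in> open_cyls" for U V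
    by (rule open_cyls2[OF UV]) (simp add: openin_Un open_cylsI flip: cyl_Un)
  show "U \<inter> V \<in> open_cyls" if UV: "U \<in> open_cyls" "V \<in> open_cyls" for U V
    by (rule open_cyls2[OF UV]) (simp add: openin_Int open_cylsI flip: cyl_Int)
  fix P P' assume P: "P \<in> topspace (weak_top X)" "P' \<in> topspace (weak_top X)" "P \<noteq> P'"
  have "\<exists>\<alpha>\<in>\<A>. \<exists>A\<in>\<alpha>. measure P A \<noteq> measure P' A"
    using measure_eq_on_partitions_imp_eq[OF ne, of P P'] P by auto
  then obtain \<alpha> A where A: "\<alpha> \<in> \<A>" "A \<in> \<alpha>" "measure P A \<noteq> measure P' A" by blast
  define c where "c = (measure P A + measure P' A) / 2"
  have cont: "continuous_map (prob_simplex_top \<alpha>) euclideanreal (\<lambda>p. p A)"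
    by (rule continuous_map_coord[OF A(2)])
  define lo where "lo = cyl \<alpha> {p \<in> prob_simplex \<alpha>. p A \<in> {..<c}}"
  define hi where "hi = cyl \<alpha> {p \<in> prob_simplex \<alpha>. p A \<in> {c<..}}"
  have mem: "lo \<in> open_cyls" "hi \<in> open_cyls"
    unfolding lo_def hi_def
    using openin_continuous_map_preimage[OF cont, of "{..<c}"]
      openin_continuous_map_preimage[OF cont, of "{c<..}"]
    by (auto intro!: open_cylsI[OF A(1)])
  have in_lo: "R \<in> lo \<longleftrightarrow> R \<in> M1 X \<and> measure R A < c" and in_hi: "R \<in> hi \<longleftrightarrow> R \<in> M1 X \<and> c < measure R A" for R
    using proj_in_simplex[OF _ partition[OF A(1)]] A(2)
    by (auto simp: lo_def hi_def cyl_def proj_def)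
  have disj: "lo \<inter> hi = {}" using in_lo in_hi by force
  show "\<exists>U\<in>open_cyls. \<exists>V\<in>open_cyls. P \<in> U \<and> P' \<in> V \<and> U \<inter> V = {}"
  proof (cases "measure P A < measure P' A")
    case True
    then show ?thesis
      using P mem disj in_lo in_hi by (intro bexI[of _ lo] bexI[of _ hi]) (auto simp: c_def)
  next
    case False
    then show ?thesis
      using P mem disj in_lo in_hi A(3) by (intro bexI[of _ hi] bexI[of _ lo]) (auto simp: c_def)
  qed
qed (rule Hausdorff_weak)

end

section \<open>Existence and uniqueness\<close>

context partition_system
begin

lemma projecting_unique:
  assumes ne: "\<A> \<noteq> {}"
    and M: "radon_prob (weak_top X) M" "\<And>\<alpha>. \<alpha> \<in> \<A> \<Longrightarrow> projects_to M \<alpha> (Pis \<alpha>)"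
    and N: "radon_prob (weak_top X) N" "\<And>\<alpha>. \<alpha> \<in> \<A> \<Longrightarrow> projects_to N \<alpha> (Pis \<alpha>)"
  shows "M = N"
proof (rule separating_family.radon_prob_unique[OF separating_family_open_cyls[OF ne] M(1) N(1)])
  fix U assume "U \<in> open_cyls"
  then obtain \<alpha> W where U: "\<alpha> \<in> \<A>" "openin (prob_simplex_top \<alpha>) W" "U = cyl \<alpha> W"
    by (auto simp: open_cyls_def)
  then show "measure M U = measure N U"
    using measure_cyl[OF M(1) U(1) borel_of_openin[OF U(2)]] M(2)[OF U(1)]
      measure_cyl[OF N(1) U(1) borel_of_openin[OF U(2)]] N(2)[OF U(1)]
    by (simp add: projects_to_def)
qed

text \<open>A vector obeying all cell bounds is the projection of its spread, which lies in the
  dominated set. If a cylinder misses this set, every point of its base violates the bound for some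
  \<open>k\<close>, and the probabilities of these violations sum to at most
  \<open>e\<close>.\<close>

lemma dominated_set_tight:
  assumes Q: "Q \<in> M1 X"
    and cond: "\<forall>\<epsilon>>0. \<forall>\<delta>>0. \<exists>L>0. \<forall>\<alpha>\<in>\<A>.
      measure (Pis \<alpha>) {p \<in> prob_simplex \<alpha>. excess Q \<alpha> L p > \<delta>} < \<epsilon>"
    and e: "e > 0"
  shows "\<exists>C. compactin (weak_top X) C \<and> (\<forall>\<alpha>\<in>\<A>. \<forall>W\<in>sets (borel_of (prob_simplex_top \<alpha>)).
    cyl \<alpha> W \<inter> C = {} \<longrightarrow> measure (Pis \<alpha>) W \<le> e)"
proof -
  define d where "d k = 1 / real (Suc k)" for k
  have d: "d \<longlonglongrightarrow> 0" "\<And>k. d k > 0"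
    unfolding d_def by (rule LIMSEQ_Suc[OF lim_1_over_n]) simp
  have "\<exists>L>0. \<forall>\<alpha>\<in>\<A>. measure (Pis \<alpha>) {p \<in> prob_simplex \<alpha>. excess Q \<alpha> L p > d k} < e * (1/2)^Suc k"
    for k
  proof -
    have "e * (1/2)^Suc k > 0" using e by simp
    then show ?thesis using cond d(2)[of k] by blast
  qed
  then have "\<exists>L. \<forall>k. L k > 0 \<and> (\<forall>\<alpha>\<in>\<A>.
      measure (Pis \<alpha>) {p \<in> prob_simplex \<alpha>. excess Q \<alpha> (L k) p > d k} < e * (1/2)^Suc k)"
    by (intro choice allI)
  then obtain L where L: "\<And>k. L k > 0" "\<And>k \<alpha>. \<alpha> \<in> \<A> \<Longrightarrow>
      measure (Pis \<alpha>) {p \<in> prob_simplex \<alpha>. excess Q \<alpha> (L k) p > d k} < e * (1/2)^Suc k"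
    by auto
  have "measure (Pis \<alpha>) W \<le> e"
    if \<alpha>: "\<alpha> \<in> \<A>" and W: "W \<in> sets (borel_of (prob_simplex_top \<alpha>))"
      and disj: "cyl \<alpha> W \<inter> dominated_set X Q L d = {}" for \<alpha> W
  proof -
    interpret prob_space "Pis \<alpha>" by (rule prob_space_Pis[OF \<alpha>])
    define G where "G k = {p \<in> prob_simplex \<alpha>. excess Q \<alpha> (L k) p > d k}" for k
    have G: "G k \<in> sets (Pis \<alpha>)" for k
    proof -
      have "openin (prob_simplex_top \<alpha>) {p \<in> topspace (prob_simplex_top \<alpha>). excess Q \<alpha> (L k) p \<in> {d k<..}}"
        using borel_partitionD(1)[OF partition[OF \<alpha>]]
        by (intro openin_continuous_map_preimage[OF continuous_map_excess]) auto
      then show ?thesis by (simp add: G_def sets_Pis[OF \<alpha>] borel_of_openin)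
    qed
    have "W \<subseteq> (\<Union>k. G k)"
    proof (rule subsetI, rule ccontr)
      fix p assume pW: "p \<in> W" and pG: "p \<notin> (\<Union>k. G k)"
      have p: "p \<in> prob_simplex \<alpha>" using sets.sets_into_space[OF W] pW by auto
      then have le: "excess Q \<alpha> (L k) p \<le> d k" for k using pG by (auto simp: G_def not_less)
      \<comment> \<open>On a \<open>Q\<close>-null cell the summand of the excess is
        \<open>p A\<close> whatever \<open>L\<close> is, so \<open>p A\<close> is at most every
        \<open>d k\<close>. This supplies the side condition of \<open>spread\<close>.\<close>
      have null: "p A = 0" if A: "A \<in> \<alpha>" "measure Q A = 0" for A
      proof -
        have "\<bar>p A - min (p A) (L k * measure Q A)\<bar> \<le> d k" for k
          using member_le_sum[of A \<alpha> "\<lambda>A. \<bar>p A - min (p A) (L k * measure Q A)\<bar>"] A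
            borel_partitionD(1)[OF partition[OF \<alpha>]] le[of k] by (simp add: excess_def)
        moreover have "p A \<ge> 0" using p A by (simp add: prob_simplex_def)
        ultimately have "p A \<le> d k" for k using A(2) by simp
        then have "p A \<le> 0" using LIMSEQ_le_const[OF d(1)] by blast
        then show ?thesis using \<open>p A \<ge> 0\<close> by simp
      qed
      have sp: "spread Q \<alpha> p \<in> M1 X" "proj \<alpha> (spread Q \<alpha> p) = p"
        "\<And>B L. B \<in> sets (borel_of X) \<Longrightarrow> L \<ge> 0 \<Longrightarrow>
          measure (spread Q \<alpha> p) B \<le> L * measure Q B + excess Q \<alpha> L p"
        using spread[OF Hausdorff_X Q partition[OF \<alpha>] p] null by auto
      have "spread Q \<alpha> p \<in> dominated_set X Q L d"
        unfolding dominated_set_def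
      proof (intro CollectI conjI allI ballI)
        show "spread Q \<alpha> p \<in> M1 X" by (rule sp(1))
        fix k B assume B: "B \<in> sets (borel_of X)"
        show "measure (spread Q \<alpha> p) B \<le> L k * measure Q B + d k"
          using sp(3)[OF B, of "L k"] L(1)[of k] le[of k] by simp
      qed
      moreover have "spread Q \<alpha> p \<in> cyl \<alpha> W"
        using sp(1,2) pW by (simp add: cyl_def)
      ultimately show False using disj by blast
    qed
    have half: "(\<lambda>k. e * (1/2)^Suc k) sums e"
      using sums_mult[OF power_half_series, of e] by simp
    have lt: "measure (Pis \<alpha>) (G k) \<le> e * (1/2)^Suc k" for k
      using L(2)[OF \<alpha>, of k] by (simp add: G_def)
    have summ: "summable (\<lambda>k. measure (Pis \<alpha>) (G k))"
      by (rule summable_comparison_test'[OF sums_summable[OF half], of 0]) (use lt in simp)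
    have "measure (Pis \<alpha>) W \<le> measure (Pis \<alpha>) (\<Union>k. G k)"
      using \<open>W \<subseteq> (\<Union>k. G k)\<close> G by (intro finite_measure_mono) auto
    also have "\<dots> \<le> (\<Sum>k. measure (Pis \<alpha>) (G k))"
      using G summ by (intro finite_measure_subadditive_countably) auto
    also have "\<dots> \<le> (\<Sum>k. e * (1/2)^Suc k)"
      using lt by (intro suminf_le summ sums_summable[OF half])
    also have "\<dots> = e" using half by (simp add: sums_iff)
    finally show ?thesis .
  qed
  then show ?thesis
    using compactin_dominated_set[OF Hausdorff_X Q d(1), of L] by blast
qed

lemma projecting_exists:
  assumes ne: "\<A> \<noteq> {}"
    and tight: "\<And>e. e > 0 \<Longrightarrow> \<exists>C. compactin (weak_top X) C \<and>
      (\<forall>\<alpha>\<in>\<A>. \<forall>W\<in>sets (borel_of (prob_simplex_top \<alpha>)).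
        cyl \<alpha> W \<inter> C = {} \<longrightarrow> measure (Pis \<alpha>) W \<le> e)"
  shows "\<exists>M. radon_prob (weak_top X) M \<and> (\<forall>\<alpha>\<in>\<A>. projects_to M \<alpha> (Pis \<alpha>))"
proof -
  let ?S = "\<lambda>\<alpha>. sets (borel_of (prob_simplex_top \<alpha>))"
  \<comment> \<open>An empty cylinder misses every \<open>C\<close>, so tightness applies with every
    \<open>e\<close>.\<close>
  have null: "measure (Pis \<alpha>) W = 0" if "\<alpha> \<in> \<A>" "W \<in> ?S \<alpha>" "cyl \<alpha> W = {}" for \<alpha> W
  proof (rule antisym[OF field_le_epsilon measure_nonneg])
    fix e :: real assume "e > 0"
    from tight[OF this] that show "measure (Pis \<alpha>) W \<le> 0 + e" by auto
  qed
  have mono: "measure (Pis \<alpha>) W \<le> measure (Pis \<alpha>) W'"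
    if \<alpha>: "\<alpha> \<in> \<A>" and W: "W \<in> ?S \<alpha>" "W' \<in> ?S \<alpha>" and le: "cyl \<alpha> W \<subseteq> cyl \<alpha> W'" for \<alpha> W W'
  proof -
    interpret prob_space "Pis \<alpha>" by (rule prob_space_Pis[OF \<alpha>])
    have "measure (Pis \<alpha>) (W - W') = 0"
      using le W by (intro null[OF \<alpha>]) (auto simp: cyl_Diff)
    moreover have "measure (Pis \<alpha>) W \<le> measure (Pis \<alpha>) ((W - W') \<union> W')"
      using W by (intro finite_measure_mono) (auto simp: sets_Pis[OF \<alpha>])
    moreover have "measure (Pis \<alpha>) ((W - W') \<union> W') \<le> measure (Pis \<alpha>) (W - W') + measure (Pis \<alpha>) W'"
      using W by (intro measure_Un_le) (auto simp: sets_Pis[OF \<alpha>])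
    ultimately show ?thesis by simp
  qed
  have wd: "measure (Pis \<alpha>) W = measure (Pis \<beta>) W'"
    if *: "\<alpha> \<in> \<A>" "W \<in> ?S \<alpha>" "\<beta> \<in> \<A>" "W' \<in> ?S \<beta>" "cyl \<alpha> W = cyl \<beta> W'" for \<alpha> \<beta> W W'
  proof -
    obtain \<gamma> where \<gamma>: "\<gamma> \<in> \<A>" "refines \<alpha> \<gamma>" "refines \<beta> \<gamma>" using common_refinement * by metis
    have "cyl \<gamma> (pull \<alpha> \<gamma> W) = cyl \<gamma> (pull \<beta> \<gamma> W')" using * \<gamma> by (simp add: cyl_pull)
    then have "measure (Pis \<gamma>) (pull \<alpha> \<gamma> W) = measure (Pis \<gamma>) (pull \<beta> \<gamma> W')"
      using * \<gamma> by (intro antisym mono) (simp_all add: sets_pull)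
    then show ?thesis using * \<gamma> by (simp add: measure_pull)
  qed
  \<comment> \<open>Tightness makes the mass of a cylinder independent of its representation (\<open>wd\<close>).\<close>
  define m where "m Z = (SOME r. \<exists>\<alpha>\<in>\<A>. \<exists>W\<in>?S \<alpha>. Z = cyl \<alpha> W \<and> r = measure (Pis \<alpha>) W)" for Z
  have m: "m (cyl \<alpha> W) = measure (Pis \<alpha>) W" if *: "\<alpha> \<in> \<A>" "W \<in> ?S \<alpha>" for \<alpha> W
    unfolding m_def
  proof (rule some_equality)
    show "\<exists>\<beta>\<in>\<A>. \<exists>V\<in>?S \<beta>. cyl \<alpha> W = cyl \<beta> V \<and> measure (Pis \<alpha>) W = measure (Pis \<beta>) V"
      using * by blast
    show "r = measure (Pis \<alpha>) W"
      if "\<exists>\<beta>\<in>\<A>. \<exists>V\<in>?S \<beta>. cyl \<alpha> W = cyl \<beta> V \<and> r = measure (Pis \<beta>) V" for r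
      using that wd[OF *] by metis
  qed
  obtain \<alpha>0 where \<alpha>0: "\<alpha>0 \<in> \<A>" using ne by blast
  have simplex_in: "prob_simplex \<alpha> \<in> ?S \<alpha>" for \<alpha>
    using sets.top[of "borel_of (prob_simplex_top \<alpha>)"] by simp
  interpret tight_content "weak_top X" open_cyls borel_cyls m
  proof (intro tight_content.intro tight_content_axioms.intro)
    show "separating_family (weak_top X) open_cyls" by (rule separating_family_open_cyls[OF ne])
    show "open_cyls \<subseteq> borel_cyls"
      using borel_of_openin by (fastforce simp: open_cyls_def borel_cyls_def)
    show "algebra (topspace (weak_top X)) borel_cyls"
      unfolding algebra_iff_Un
    proof (intro conjI ballI)
      show "borel_cyls \<subseteq> Pow (topspace (weak_top X))" by (auto simp: borel_cyls_def cyl_def)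
      show "{} \<in> borel_cyls" using borel_cylsI[OF \<alpha>0, of "{}"] by (simp add: cyl_empty)
      show "topspace (weak_top X) - a \<in> borel_cyls" if a': "a \<in> borel_cyls" for a
      proof -
        obtain \<alpha> W where a: "\<alpha> \<in> \<A>" "W \<in> ?S \<alpha>" "a = cyl \<alpha> W"
          using a' by (auto simp: borel_cyls_def)
        then have "topspace (weak_top X) - a = cyl \<alpha> (prob_simplex \<alpha> - W)"
          by (simp add: cyl_Diff cyl_simplex)
        moreover have "prob_simplex \<alpha> - W \<in> ?S \<alpha>" using simplex_in a(2) by (rule sets.Diff)
        ultimately show ?thesis using a(1) borel_cylsI by metis
      qed
      show "a \<union> b \<in> borel_cyls" if ab: "a \<in> borel_cyls" "b \<in> borel_cyls" for a b
        by (rule borel_cyls2[OF ab]) (simp add: borel_cylsI sets.Un flip: cyl_Un)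
    qed
    show "0 \<le> m Z" if "Z \<in> borel_cyls" for Z
      using that m by (auto simp: borel_cyls_def)
    show "m (topspace (weak_top X)) = 1"
      using m[OF \<alpha>0 simplex_in] prob_space.prob_space[OF prob_space_Pis[OF \<alpha>0]]
      by (simp add: cyl_simplex[OF \<alpha>0] space_Pis[OF \<alpha>0])
    show "m (Z \<union> Z') = m Z + m Z'"
      if Z: "Z \<in> borel_cyls" "Z' \<in> borel_cyls" "Z \<inter> Z' = {}" for Z Z'
    proof -
      obtain \<gamma> W W' where \<gamma>: "\<gamma> \<in> \<A>" "W \<in> ?S \<gamma>" "W' \<in> ?S \<gamma>" "Z = cyl \<gamma> W" "Z' = cyl \<gamma> W'"
        using borel_cyls2[OF Z(1,2)] by metis
      interpret prob_space "Pis \<gamma>" by (rule prob_space_Pis[OF \<gamma>(1)])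
      \<comment> \<open>Disjointness is given for the cylinders; for their bases \<open>null\<close>
        yields an overlap of mass 0, which is enough for additivity.\<close>
      have "measure (Pis \<gamma>) (W' \<inter> W) = 0"
        using Z(3) \<gamma> by (intro null) (auto simp: cyl_Int)
      then have "measure (Pis \<gamma>) (W \<union> W') = measure (Pis \<gamma>) W + measure (Pis \<gamma>) W'"
        using \<gamma> finite_measure_Union'[of W W'] finite_measure_Diff'[of W' W] by (simp add: sets_Pis)
      then show ?thesis using \<gamma> by (simp add: m sets.Un flip: cyl_Un)
    qed
    show "\<exists>C. compactin (weak_top X) C \<and> (\<forall>Z\<in>borel_cyls. Z \<inter> C = {} \<longrightarrow> m Z \<le> e)" if e: "e > 0" for e
    proof -
      obtain C where C: "compactin (weak_top X) C" "\<And>\<alpha> W. \<alpha> \<in> \<A> \<Longrightarrow> W \<in> ?S \<alpha> \<Longrightarrow>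
        cyl \<alpha> W \<inter> C = {} \<Longrightarrow> measure (Pis \<alpha>) W \<le> e" using tight[OF e] by blast
      then show ?thesis by (intro exI[of _ C]) (auto simp: borel_cyls_def m)
    qed
  qed
  obtain M where M: "radon_prob (weak_top X) M" "\<And>U. U \<in> open_cyls \<Longrightarrow> measure M U \<le> m U"
    using radon_extension by blast
  interpret M: prob_space M by (rule radon_probD[OF M(1)])
  have "projects_to M \<alpha> (Pis \<alpha>)" if \<alpha>: "\<alpha> \<in> \<A>" for \<alpha>
    unfolding projects_to_def
  proof -
    interpret P: prob_space "Pis \<alpha>" by (rule prob_space_Pis[OF \<alpha>])
    define D where "D = distr M (borel_of (prob_simplex_top \<alpha>)) (proj \<alpha>)"
    have sD: "sets D = ?S \<alpha>" by (simp add: D_def)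
    have D: "measure D W = measure M (cyl \<alpha> W)" if "W \<in> ?S \<alpha>" for W
      unfolding D_def by (rule measure_cyl[OF M(1) \<alpha> that])
    interpret D: prob_space D
      unfolding D_def
      using continuous_map_measurable[OF continuous_map_proj[OF partition[OF \<alpha>]]]
        measurable_cong_sets[OF radon_probD(1)[OF M(1)] refl] by (intro M.prob_space_distr) blast
    \<comment> \<open>Complements turn this upper bound on open sets into a lower bound on closed
      sets. Open subsets of the metrizable simplex are increasing unions of closed sets, so the two
      bounds meet.\<close>
    have upper: "measure D W \<le> measure (Pis \<alpha>) W" if "openin (prob_simplex_top \<alpha>) W" for W
      using M(2)[OF open_cylsI[OF \<alpha> that]] borel_of_openin[OF that] D m[OF \<alpha>] by simp
    have lower: "measure (Pis \<alpha>) F \<le> measure D F" if F: "closedin (prob_simplex_top \<alpha>) F" for F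
    proof -
      have "openin (prob_simplex_top \<alpha>) (prob_simplex \<alpha> - F)" using F by (simp add: closedin_def)
      from upper[OF this] show ?thesis
        using P.prob_compl[of F] D.prob_compl[of F] borel_of_closedin[OF F] sD
          sets_eq_imp_space_eq[OF sD] by (simp add: sets_Pis[OF \<alpha>] space_Pis[OF \<alpha>])
    qed
    have eq: "measure (Pis \<alpha>) W = measure D W" if W: "openin (prob_simplex_top \<alpha>) W" for W
    proof (rule antisym[OF _ upper[OF W]])
      have "fsigma_in (prob_simplex_top \<alpha>) W"
        using borel_partitionD(1)[OF partition[OF \<alpha>]] W
        by (intro open_imp_fsigma_in metrizable_prob_simplex_top)
      then obtain F where F: "\<And>n. closedin (prob_simplex_top \<alpha>) (F n)"
        "\<And>n. F n \<subseteq> F (Suc n)" "\<Union> (range F) = W"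
        unfolding fsigma_in_ascending by metis
      have "(\<lambda>n. measure (Pis \<alpha>) (F n)) \<longlonglongrightarrow> measure (Pis \<alpha>) (\<Union>n. F n)"
        using F borel_of_closedin[OF F(1)]
        by (intro P.finite_Lim_measure_incseq) (auto simp: sets_Pis[OF \<alpha>] intro!: incseq_SucI)
      moreover have "measure (Pis \<alpha>) (F n) \<le> measure D W" for n
        using lower[OF F(1)] D.finite_measure_mono[of "F n" W] F(3) borel_of_openin[OF W] sD
        by (smt (verit) UN_upper UNIV_I)
      ultimately show "measure (Pis \<alpha>) W \<le> measure D W"
        using F(3) LIMSEQ_le_const2 by metis
    qed
    show "Pis \<alpha> = distr M (borel_of (prob_simplex_top \<alpha>)) (proj \<alpha>)"
      unfolding D_def[symmetric]
    proof (rule measure_eqI_generator_eq[where E="{U. openin (prob_simplex_top \<alpha>) U}"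
          and \<Omega>="prob_simplex \<alpha>" and A="\<lambda>_. prob_simplex \<alpha>"])
      show "Int_stable {U. openin (prob_simplex_top \<alpha>) U}" by (auto simp: Int_stable_def)
      show "{U. openin (prob_simplex_top \<alpha>) U} \<subseteq> Pow (prob_simplex \<alpha>)"
        by (metis PowI mem_Collect_eq openin_subset subsetI topspace_prob_simplex_top)
      show "sets (Pis \<alpha>) = sigma_sets (prob_simplex \<alpha>) {U. openin (prob_simplex_top \<alpha>) U}"
        "sets D = sigma_sets (prob_simplex \<alpha>) {U. openin (prob_simplex_top \<alpha>) U}"
        using sD by (simp_all add: sets_Pis[OF \<alpha>] sets_borel_of)
      show "range (\<lambda>_. prob_simplex \<alpha>) \<subseteq> {U. openin (prob_simplex_top \<alpha>) U}"
        using openin_topspace[of "prob_simplex_top \<alpha>"] by simp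
    qed (use eq in \<open>auto simp: P.emeasure_eq_measure D.emeasure_eq_measure\<close>)
  qed
  then show ?thesis using M(1) by blast
qed

text \<open>Without partitions, \<open>resolves\<close> forces the Borel sigma-algebra to be
  trivial.\<close>

lemma M1_subsingleton:
  assumes "\<A> = {}" "P \<in> M1 X" "Q \<in> M1 X"
  shows "P = Q"
proof (rule measure_eqI)
  interpret P: prob_space P by (rule M1_D[OF assms(2)])
  interpret Q: prob_space Q by (rule M1_D[OF assms(3)])
  show "sets P = sets Q" using M1_D(3) assms by blast
  have "sets (borel_of X) = {{}, topspace X}"
    using resolves assms(1) by (simp add: resolves_def sigma_sets_empty_eq)
  then show "emeasure P B = emeasure Q B" if "B \<in> sets P" for B
    using that M1_D(3,4)[OF assms(2)] M1_D(4)[OF assms(3)] P.emeasure_space_1 Q.emeasure_space_1 by auto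
qed

text \<open>With no partition there are no cylinders, so the general construction cannot start.
  \<open>M1 X\<close> is then a single point, and the trivial lattice with a 0-1 content fits the
  same extension and uniqueness results.\<close>

lemma radon_prob_ex1_if_no_partitions:
  assumes no: "\<A> = {}" and Q: "Q \<in> M1 X"
  shows "\<exists>!M. radon_prob (weak_top X) M"
proof -
  have M1: "M1 X = {Q}" using M1_subsingleton[OF no] Q by blast
  define m :: "'a measure set \<Rightarrow> real" where "m Z = (if Z = {} then 0 else 1)" for Z
  interpret tight_content "weak_top X" "{{}, M1 X}" "{{}, M1 X}" m
  proof (intro tight_content.intro tight_content_axioms.intro separating_family.intro)
    show "Hausdorff_space (weak_top X)" by (rule Hausdorff_weak)
    show "algebra (topspace (weak_top X)) {{}, M1 X}" by (auto simp: algebra_iff_Un)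
    show "\<exists>C. compactin (weak_top X) C \<and>
        (\<forall>Z\<in>{{}, M1 X}. Z \<inter> C = {} \<longrightarrow> m Z \<le> e)" if "e > 0" for e :: real
      using that Q by (intro exI[of _ "{Q}"]) (auto simp: m_def)
  qed (use M1 openin_topspace[of "weak_top X"] in \<open>auto simp: m_def\<close>)
  have "M = N" if "radon_prob (weak_top X) M" "radon_prob (weak_top X) N" for M N
  proof (rule radon_prob_unique[OF that])
    fix U assume "U \<in> {{}, M1 X}"
    then show "measure M U = measure N U"
      using prob_space.prob_space[OF radon_probD(2)[OF that(1)]] radon_probD(3)[OF that(1)]
        prob_space.prob_space[OF radon_probD(2)[OF that(2)]] radon_probD(3)[OF that(2)] by auto
  qed
  then show ?thesis using radon_extension by blast
qed

end

section \<open>Domination of compact sets of measures\<close>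

text \<open>The measures in \<open>K\<close> violating the bound form compact sets
  \<open>C n\<close>, since evaluation at \<open>D n\<close> is continuous, and each single measure
  eventually leaves them. Decreasing compacts with empty intersection reach the empty set.\<close>

lemma compact_uniform_continuity_from_above:
  assumes X: "Hausdorff_space (weak_top X)" and K: "compactin (weak_top X) K"
    and D: "range D \<subseteq> sets (borel_of X)" "decseq D" "(\<Inter>n. D n) = {}" and e: "e > 0"
  shows "\<exists>n. \<forall>P\<in>K. measure P (D n) < e"
proof -
  have KM: "K \<subseteq> M1 X" using compactin_subset_topspace[OF K] by simp
  have Ds: "D n \<in> sets (borel_of X)" for n using D(1) by auto
  define C where "C n = {P \<in> K. e \<le> measure P (D n)}" for n
  have "compactin (weak_top X) (C n)" for n
  proof -
    have "closedin (weak_top X) {P \<in> topspace (weak_top X). measure P (D n) \<in> {e..}}"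
      by (rule closedin_continuous_map_preimage[OF continuous_map_measure[OF Ds]]) simp
    moreover have "C n = K \<inter> {P \<in> topspace (weak_top X). measure P (D n) \<in> {e..}}"
      using KM by (auto simp: C_def)
    ultimately show ?thesis using compact_Int_closedin[OF K] by simp
  qed
  moreover have "decseq C"
  proof (rule decseq_SucI, rule subsetI)
    fix n P assume P: "P \<in> C (Suc n)"
    then have PM: "P \<in> M1 X" using KM by (auto simp: C_def)
    interpret prob_space P by (rule M1_D[OF PM])
    have "measure P (D (Suc n)) \<le> measure P (D n)"
      using D(2) Ds M1_D(3)[OF PM] by (intro finite_measure_mono) (auto simp: decseq_Suc_iff)
    then show "P \<in> C n" using P by (auto simp: C_def)
  qed
  moreover have "(\<Inter>n. C n) \<subseteq> {}"
  proof
    fix P assume P: "P \<in> (\<Inter>n. C n)"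
    then have PM: "P \<in> M1 X" using KM by (auto simp: C_def)
    interpret prob_space P by (rule M1_D[OF PM])
    have "(\<lambda>n. measure P (D n)) \<longlonglongrightarrow> measure P (\<Inter>n. D n)"
      using D M1_D(3)[OF PM] by (intro finite_Lim_measure_decseq) auto
    moreover have "e \<le> measure P (D n)" for n using P by (auto simp: C_def)
    ultimately have "e \<le> measure P (\<Inter>n. D n)" using LIMSEQ_le_const by blast
    then show "P \<in> {}" using D(3) e by simp
  qed
  ultimately obtain n where "C n \<subseteq> {}"
    using compactin_decseq_subset[OF X _ _ openin_empty, of C] by metis
  then show ?thesis by (intro exI[of _ n]) (auto simp: C_def not_le)
qed

text \<open>If the conclusion failed, one could pick \<open>P\<^sub>n \<in> K\<close> and \<open>B\<^sub>n\<close> with \<open>P\<^sub>n B\<^sub>n \<ge> e\<close> but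
  \<open>P\<^sub>i B\<^sub>n < 2\<^sup>-\<^sup>n\<close> for \<open>i < n\<close>; by Borel--Cantelli the upper limit of the \<open>B\<^sub>n\<close> is null for every
  \<open>P\<^sub>i\<close>, and the tails without it contradict uniform continuity from above.\<close>

lemma compact_uniformly_dominated:
  assumes X: "Hausdorff_space (weak_top X)" and K: "compactin (weak_top X) K" and e: "e > 0"
  shows "\<exists>F d. finite F \<and> F \<subseteq> K \<and> d > 0 \<and>
    (\<forall>B\<in>sets (borel_of X). (\<forall>P\<in>F. measure P B < d) \<longrightarrow> (\<forall>P\<in>K. measure P B < e))"
proof (rule ccontr)
  assume neg: "\<not> ?thesis"
  have KM: "K \<subseteq> M1 X" using compactin_subset_topspace[OF K] by simp
  have step: "\<exists>P B. P \<in> K \<and> B \<in> sets (borel_of X) \<and> (\<forall>R\<in>F. measure R B < d) \<and> e \<le> measure P B"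
    if "finite F" "F \<subseteq> K" "d > 0" for F d
    using neg that by (meson not_less)
  define good where "good F d PB \<longleftrightarrow> fst PB \<in> K \<and> snd PB \<in> sets (borel_of X) \<and>
    (\<forall>R\<in>F. measure R (snd PB) < d) \<and> e \<le> measure (fst PB) (snd PB)" for F d PB
  define pick where "pick F d = (SOME PB. good F d PB)" for F d
  have pick: "good F d (pick F d)" if "finite F" "F \<subseteq> K" "d > 0" for F d
    unfolding pick_def using step[OF that] by (intro someI_ex[of "good F d"]) (auto simp: good_def)
  \<comment> \<open>\<open>\<F> n\<close> holds the measures picked before stage \<open>n\<close>;
    the set picked at stage \<open>n\<close> has mass below \<open>(1/2)^n\<close> under all of
    them.\<close>
  define \<F> where "\<F> = rec_nat {} (\<lambda>n F. insert (fst (pick F ((1/2)^n))) F)"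
  have \<F>: "\<F> 0 = {}" "\<F> (Suc n) = insert (fst (pick (\<F> n) ((1/2)^n))) (\<F> n)" for n
    by (simp_all add: \<F>_def)
  define P where "P n = fst (pick (\<F> n) ((1/2)^n))" for n
  define B where "B n = snd (pick (\<F> n) ((1/2)^n))" for n
  have fin: "finite (\<F> n) \<and> \<F> n \<subseteq> K" for n
  proof (induction n)
    case (Suc n)
    then have "good (\<F> n) ((1/2)^n) (pick (\<F> n) ((1/2)^n))" by (intro pick) auto
    then show ?case using Suc by (simp add: \<F> good_def)
  qed (simp add: \<F>)
  have good: "P n \<in> K" "B n \<in> sets (borel_of X)" "\<And>R. R \<in> \<F> n \<Longrightarrow> measure R (B n) < (1/2)^n"
    "e \<le> measure (P n) (B n)" for n
    using pick[of "\<F> n" "(1/2)^n"] fin[of n] by (auto simp: good_def P_def B_def)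
  have mem: "P i \<in> \<F> n" if "i < n" for i n
    using that by (induction n) (auto simp: \<F> P_def less_Suc_eq)
  define C where "C n = (\<Union>m\<in>{n..}. B m)" for n
  have Cs: "C n \<in> sets (borel_of X)" for n
    unfolding C_def using good(2) by (intro sets.countable_UN'') auto
  define N where "N = (\<Inter>n. C n)"
  have Ns: "N \<in> sets (borel_of X)" unfolding N_def using Cs by auto
  have null: "measure (P i) N = 0" for i
  proof -
    have PM: "P i \<in> M1 X" using good(1) KM by blast
    interpret prob_space "P i" by (rule M1_D[OF PM])
    have sP: "sets (P i) = sets (borel_of X)" by (rule M1_D(3)[OF PM])
    \<comment> \<open>Only sets picked after stage \<open>i\<close> are known to be small for
      \<open>P i\<close>, hence the restriction to \<open>n\<close> above \<open>i\<close>.\<close>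
    have "measure (P i) N \<le> 2 * (1/2)^n" if n: "i < n" for n
    proof -
      have lt: "measure (P i) (B (n + m)) \<le> (1/2)^n * (1/2)^m" for m
        using good(3)[OF mem[of i "n + m"]] n by (simp add: power_add less_imp_le)
      have geo: "(\<lambda>m. (1/2::real)^n * (1/2)^m) sums ((1/2)^n * 2)"
        using sums_mult[OF geometric_sums[of "1/2::real"], of "(1/2)^n"] by simp
      have summ: "summable (\<lambda>m. measure (P i) (B (n + m)))"
        by (rule summable_comparison_test'[OF sums_summable[OF geo], of 0]) (use lt in simp)
      have "N \<subseteq> (\<Union>m. B (n + m))"
      proof
        fix x assume "x \<in> N"
        then have "x \<in> C n" by (auto simp: N_def)
        then obtain j where "n \<le> j" "x \<in> B j" by (auto simp: C_def)
        then show "x \<in> (\<Union>m. B (n + m))" by (intro UN_I[of "j - n"]) auto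
      qed
      then have "measure (P i) N \<le> measure (P i) (\<Union>m. B (n + m))"
        using good(2) sP by (intro finite_measure_mono) auto
      also have "\<dots> \<le> (\<Sum>m. measure (P i) (B (n + m)))"
        using good(2) sP summ by (intro finite_measure_subadditive_countably) auto
      also have "\<dots> \<le> (\<Sum>m. (1/2)^n * (1/2)^m)"
        by (intro suminf_le summ sums_summable[OF geo] lt)
      also have "\<dots> = 2 * (1/2)^n" using geo by (simp add: sums_iff)
      finally show ?thesis .
    qed
    moreover have "(\<lambda>n. 2 * (1/2::real)^n) \<longlonglongrightarrow> 0"
      by (intro tendsto_mult_right_zero LIMSEQ_power_zero) simp
    ultimately have "measure (P i) N \<le> 0"
      by (intro LIMSEQ_le_const[where X="\<lambda>n. 2 * (1/2::real)^n"]) (auto intro!: exI[of _ "Suc i"])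
    then show ?thesis by (simp add: measure_le_0_iff)
  qed
  have "\<exists>n. \<forall>R\<in>K. measure R (C n - N) < e"
  proof (rule compact_uniform_continuity_from_above[OF X K _ _ _ e])
    show "range (\<lambda>n. C n - N) \<subseteq> sets (borel_of X)" using Cs Ns by auto
    have "C (Suc n) \<subseteq> C n" for n unfolding C_def by (intro UN_mono) auto
    then show "decseq (\<lambda>n. C n - N)" by (intro decseq_SucI) blast
    show "(\<Inter>n. C n - N) = {}" by (auto simp: N_def)
  qed
  then obtain n where n: "measure (P n) (C n - N) < e" using good(1) by blast
  have PM: "P n \<in> M1 X" using good(1) KM by blast
  interpret prob_space "P n" by (rule M1_D[OF PM])
  have sP: "sets (P n) = sets (borel_of X)" by (rule M1_D(3)[OF PM])
  have "measure (P n) (B n) \<le> measure (P n) ((C n - N) \<union> N)"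
    using Cs Ns sP by (intro finite_measure_mono) (auto simp: C_def)
  also have "\<dots> \<le> measure (P n) (C n - N) + measure (P n) N"
    using Cs Ns sP by (intro measure_Un_le) auto
  also have "\<dots> < e" using n null by simp
  finally show False using good(4)[of n] by simp
qed

text \<open>Weights positive at every index give each \<open>P n\<close> the factor
  \<open>inverse (pmf w n)\<close>. For the Radon property a tail of small weight is given up, so
  that only finitely many compacts are united; an infinite union need not be compact.\<close>

lemma countable_mixture:
  fixes P :: "nat \<Rightarrow> 'a measure"
  assumes X: "Hausdorff_space X" and P: "\<And>n. P n \<in> M1 X"
  shows "\<exists>Q\<in>M1 X. \<forall>n. \<exists>c>0. \<forall>B\<in>sets (borel_of X). measure (P n) B \<le> c * measure Q B"
proof -
  define w where "w = geometric_pmf (1/2)"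
  have w: "pmf w n > 0" for n by (simp add: w_def)
  define Q where "Q = measure_pmf w \<bind> P"
  have Ps: "P \<in> measure_pmf w \<rightarrow>\<^sub>M subprob_algebra (borel_of X)"
    using M1_D(2,3)[OF P]
    by (auto simp: space_subprob_algebra intro!: prob_space_imp_subprob_space)
  have sQ: "sets Q = sets (borel_of X)"
    unfolding Q_def using M1_D(3)[OF P] by (intro sets_bind) auto
  have eQ: "emeasure Q B = (\<integral>\<^sup>+n. emeasure (P n) B \<partial>measure_pmf w)"
    if "B \<in> sets (borel_of X)" for B
    unfolding Q_def using Ps that by (intro emeasure_bind) auto
  have "prob_space Q"
    unfolding Q_def using M1_D(2)[OF P] Ps
    by (intro prob_space.prob_space_bind[OF prob_space_measure_pmf]) auto
  then interpret Q: prob_space Q .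
  have le: "measure (P n) B \<le> inverse (pmf w n) * measure Q B" if B: "B \<in> sets (borel_of X)" for n B
  proof -
    interpret P: prob_space "P n" by (rule M1_D[OF P])
    have "ennreal (measure (P n) B * pmf w n) = (\<integral>\<^sup>+k. emeasure (P n) B * indicator {n} k \<partial>measure_pmf w)"
      by (simp add: nn_integral_cmult_indicator emeasure_pmf_single P.emeasure_eq_measure ennreal_mult)
    also have "\<dots> \<le> (\<integral>\<^sup>+k. emeasure (P k) B \<partial>measure_pmf w)"
      by (intro nn_integral_mono) (auto simp: indicator_def)
    also have "\<dots> = ennreal (measure Q B)" using eQ[OF B] by (simp add: Q.emeasure_eq_measure)
    finally have "measure (P n) B * pmf w n \<le> measure Q B" by simp
    then show ?thesis using w[of n] by (simp add: field_simps)
  qed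
  have "radon_prob X Q"
  proof (rule radon_probI[OF X sQ \<open>prob_space Q\<close>])
    fix B and e :: real assume B: "B \<in> sets Q" and e: "e > 0"
    have "\<exists>K. compactin X K \<and> K \<subseteq> B \<and> K \<in> sets (borel_of X) \<and> measure (P n) B < measure (P n) K + e/2" for n
    proof -
      have "B \<in> sets (P n)" using B sQ M1_D(3)[OF P] by simp
      moreover have "e/2 > 0" using e by simp
      ultimately show ?thesis
        using radon_prob_inner[OF X M1_D(1)[OF P[of n]]] M1_D(3)[OF P[of n]] by metis
    qed
    then obtain K where K: "\<And>n. compactin X (K n)" "\<And>n. K n \<subseteq> B" "\<And>n. K n \<in> sets (borel_of X)"
      "\<And>n. measure (P n) B < measure (P n) (K n) + e/2" by metis
    have "(\<lambda>n. measure (measure_pmf w) {n..}) \<longlonglongrightarrow> measure (measure_pmf w) (\<Inter>n. {n..})"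
      by (intro measure_pmf.finite_Lim_measure_decseq) (auto simp: decseq_def)
    moreover have "(\<Inter>n::nat. {n..}) = {}" using not_less_eq_eq by blast
    ultimately have "(\<lambda>n. measure (measure_pmf w) {n..}) \<longlonglongrightarrow> 0" by simp
    then obtain n where n: "measure (measure_pmf w) {n..} < e/2"
      using e LIMSEQ_D[of _ 0 "e/2"] by fastforce
    define C where "C = (\<Union>i<n. K i)"
    have C: "compactin X C" "C \<subseteq> B" "C \<in> sets (borel_of X)"
      unfolding C_def using K by (auto intro!: compactin_Union)
    \<comment> \<open>Below \<open>n\<close> the choice of \<open>K i\<close> pays; from
      \<open>n\<close> on the trivial bound 1 is used, which the mixture weights by less than
      \<open>e/2\<close>.\<close>
    have small: "emeasure (P i) (B - C) \<le> ennreal (e/2) + indicator {n..} i" for i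
    proof -
      interpret P: prob_space "P i" by (rule M1_D[OF P])
      have sP: "sets (P i) = sets Q" using M1_D(3)[OF P] sQ by simp
      show ?thesis
      proof (cases "i < n")
        case True
        have "measure (P i) (B - C) \<le> measure (P i) (B - K i)"
          using True B K(3) sP sQ C(3) by (intro P.finite_measure_mono) (auto simp: C_def)
        also have "\<dots> = measure (P i) B - measure (P i) (K i)"
          using B K(2,3) sP sQ by (intro P.finite_measure_Diff) auto
        also have "\<dots> \<le> e/2" using K(4)[of i] by simp
        finally show ?thesis using True by (simp add: P.emeasure_eq_measure ennreal_leI)
      next
        case False
        have "emeasure (P i) (B - C) \<le> 1" by (rule P.emeasure_le_1)
        then show ?thesis using False by (simp add: add_increasing)
      qed
    qed
    have "emeasure Q (B - C) \<le> (\<integral>\<^sup>+i. ennreal (e/2) + indicator {n..} i \<partial>measure_pmf w)"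
      using B C(3) sQ small by (subst eQ) (auto intro!: nn_integral_mono)
    also have "\<dots> = ennreal (e/2) + emeasure (measure_pmf w) {n..}"
      by (subst nn_integral_add) (auto simp: measure_pmf.emeasure_space_1)
    also have "\<dots> \<le> ennreal (e/2) + ennreal (e/2)"
      using n by (intro add_left_mono) (simp add: measure_pmf.emeasure_eq_measure ennreal_leI)
    also have "\<dots> = ennreal e" using e by (simp flip: ennreal_plus)
    finally have "measure Q (B - C) \<le> e" using e by (simp add: Q.emeasure_eq_measure)
    then show "\<exists>K. compactin X K \<and> K \<subseteq> B \<and> measure Q B \<le> measure Q K + e"
      using C B sQ Q.finite_measure_Diff[of B C] by (intro exI[of _ C]) auto
  qed
  then have "Q \<in> M1 X" by (simp add: M1_def)
  then show ?thesis using le w by (intro bexI[of _ Q] allI) (metis inverse_positive_iff_positive)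
qed

text \<open>The excess equals the \<open>P\<close>-mass minus \<open>L\<close> times the
  \<open>Q\<close>-mass of the single set \<open>\<Union>S\<close>, where \<open>S\<close> collects
  the cells with positive excess. Being nonnegative, it forces
  \<open>measure Q (\<Union>S) \<le> 1/L = \<eta>/2\<close>; the factor 2 in \<open>L\<close> yields
  the strict inequality that \<open>ac\<close> requires. The constant \<open>2/\<eta>\<close> does
  not depend on \<open>\<alpha>\<close>.\<close>

lemma excess_proj_le:
  assumes P: "P \<in> M1 X" and Q: "Q \<in> M1 X" and \<alpha>: "borel_partition X \<alpha>"
    and d: "d > 0" and \<eta>: "\<eta> > 0"
    and ac: "\<And>B. B \<in> sets (borel_of X) \<Longrightarrow> measure Q B < \<eta> \<Longrightarrow> measure P B < d"
  shows "excess Q \<alpha> (2/\<eta>) (proj \<alpha> P) \<le> d"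
proof -
  define L where "L = 2/\<eta>"
  define S where "S = {A\<in>\<alpha>. L * measure Q A < measure P A}"
  note \<alpha>' = borel_partitionD[OF \<alpha>]
  interpret P: prob_space P by (rule M1_D[OF P])
  have S: "finite S" "disjoint S" "S \<subseteq> sets (borel_of X)" "S \<subseteq> \<alpha>"
    using \<alpha>' by (auto simp: S_def disjoint_def)
  have Ss: "\<Union>S \<in> sets (borel_of X)" using S by (intro sets.finite_Union) auto
  have sum: "measure R (\<Union>S) = (\<Sum>A\<in>S. measure R A)" if "R \<in> M1 X" for R
  proof -
    have "A \<inter> \<Union>S = A" if "A \<in> S" for A using that by blast
    then show ?thesis using measure_disjoint_sum[OF that S(1-3) Ss] by simp
  qed
  have "excess Q \<alpha> L (proj \<alpha> P) = (\<Sum>A\<in>\<alpha>. \<bar>measure P A - min (measure P A) (L * measure Q A)\<bar>)"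
    by (simp add: excess_def proj_def)
  also have "\<dots> = (\<Sum>A\<in>S. \<bar>measure P A - min (measure P A) (L * measure Q A)\<bar>)"
    using \<alpha>'(1) by (intro sum.mono_neutral_right) (auto simp: S_def)
  also have "\<dots> = (\<Sum>A\<in>S. measure P A - L * measure Q A)"
    by (intro sum.cong) (auto simp: S_def)
  also have "\<dots> = measure P (\<Union>S) - L * measure Q (\<Union>S)"
    by (simp add: sum[OF P] sum[OF Q] sum_subtractf sum_distrib_left)
  finally have eq: "excess Q \<alpha> L (proj \<alpha> P) = measure P (\<Union>S) - L * measure Q (\<Union>S)" .
  have "0 \<le> excess Q \<alpha> L (proj \<alpha> P)" by (simp add: excess_def sum_nonneg)
  then have "L * measure Q (\<Union>S) \<le> 1" using eq P.prob_le_1[of "\<Union>S"] by linarith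
  then have "measure Q (\<Union>S) < \<eta>" using \<eta> by (simp add: L_def field_simps)
  then have "measure P (\<Union>S) < d" by (rule ac[OF Ss])
  moreover have "0 \<le> L * measure Q (\<Union>S)" using \<eta> by (simp add: L_def)
  ultimately show ?thesis using eq by (simp add: L_def)
qed

text \<open>\<open>Q\<close> must be fixed before \<open>\<epsilon>\<close> and
  \<open>\<delta>\<close>. Replacing these by reciprocals of integers leaves countably many pairs:
  \<open>n\<close> selects a compact carrying mass above \<open>1 - \<epsilon>\<close>,
  \<open>k\<close> a level below \<open>\<delta>\<close>, and one mixture dominates all the finite
  sets \<open>F n k\<close> at once.\<close>

lemma (in partition_system) projecting_imp_domination:
  assumes M: "radon_prob (weak_top X) M" "\<And>\<alpha>. \<alpha> \<in> \<A> \<Longrightarrow> projects_to M \<alpha> (Pis \<alpha>)"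
  shows "\<exists>Q\<in>M1 X. \<forall>\<epsilon>>0. \<forall>\<delta>>0. \<exists>L>0. \<forall>\<alpha>\<in>\<A>.
    measure (Pis \<alpha>) {p \<in> prob_simplex \<alpha>. excess Q \<alpha> L p > \<delta>} < \<epsilon>"
proof -
  interpret M: prob_space M by (rule radon_probD[OF M(1)])
  have spM: "space M = M1 X" using radon_probD(3)[OF M(1)] by simp
  obtain P0 where P0: "P0 \<in> M1 X" using M.not_empty spM by blast
  have "\<exists>K. compactin (weak_top X) K \<and> K \<in> sets M \<and> 1 < measure M K + 1 / real (Suc n)" for n
    using radon_prob_inner[OF Hausdorff_weak M(1) sets.top, of "1 / real (Suc n)"] M.prob_space
    by (metis of_nat_0_less_iff zero_less_Suc zero_less_divide_1_iff)
  then obtain K where K: "\<And>n. compactin (weak_top X) (K n)" "\<And>n. K n \<in> sets M"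
    "\<And>n. 1 < measure M (K n) + 1 / real (Suc n)" by metis
  have KM: "K n \<subseteq> M1 X" for n using compactin_subset_topspace[OF K(1)] by simp
  have "\<forall>n k. \<exists>F d. finite F \<and> F \<subseteq> K n \<and> d > 0 \<and>
    (\<forall>B\<in>sets (borel_of X). (\<forall>P\<in>F. measure P B < d) \<longrightarrow> (\<forall>P\<in>K n. measure P B < 1 / real (Suc k)))"
    using compact_uniformly_dominated[OF Hausdorff_weak K(1)] by simp
  then obtain F d where F: "\<And>n k. finite (F n k)" "\<And>n k. F n k \<subseteq> K n" "\<And>n k. d n k > (0::real)"
    "\<And>n k B P. B \<in> sets (borel_of X) \<Longrightarrow> (\<forall>P\<in>F n k. measure P B < d n k) \<Longrightarrow> P \<in> K n \<Longrightarrow>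
      measure P B < 1 / real (Suc k)" by metis
  \<comment> \<open>\<open>P0\<close> keeps \<open>S\<close> non-empty for
    \<open>from_nat_into\<close>, even if all the \<open>F n k\<close> are empty.\<close>
  define S where "S = insert P0 (\<Union>n k. F n k)"
  have S: "countable S" "S \<noteq> {}"
    unfolding S_def using F(1) by (auto simp: countable_finite)
  have "F n k \<subseteq> M1 X" for n k using F(2) KM by (rule order_trans)
  then have SM: "S \<subseteq> M1 X" unfolding S_def using P0 by blast
  have "from_nat_into S n \<in> M1 X" for n using SM from_nat_into[OF S(2)] by blast
  then obtain Q where Q: "Q \<in> M1 X" "\<And>n. \<exists>c>0. \<forall>B\<in>sets (borel_of X).
      measure (from_nat_into S n) B \<le> c * measure Q B"
    using countable_mixture[OF Hausdorff_X, of "from_nat_into S"] by blast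
  have dom: "\<exists>c>0. \<forall>B\<in>sets (borel_of X). measure P B \<le> c * measure Q B" if "P \<in> S" for P
    using Q(2) from_nat_into_surj[OF S(1) that] by metis
  show ?thesis
  proof (intro bexI[OF _ Q(1)] allI impI)
    fix \<epsilon> \<delta> :: real assume \<epsilon>: "\<epsilon> > 0" and \<delta>: "\<delta> > 0"
    obtain n where n: "1 / real (Suc n) < \<epsilon>" using nat_approx_posE[OF \<epsilon>] by metis
    obtain k where k: "1 / real (Suc k) < \<delta>" using nat_approx_posE[OF \<delta>] by metis
    have "F n k \<subseteq> S" by (auto simp: S_def)
    then have "\<forall>P\<in>F n k. \<exists>c>0. \<forall>B\<in>sets (borel_of X). measure P B \<le> c * measure Q B"
      using dom by blast
    then obtain c where c: "\<And>P. P \<in> F n k \<Longrightarrow> c P > (0::real)"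
      "\<And>P B. P \<in> F n k \<Longrightarrow> B \<in> sets (borel_of X) \<Longrightarrow> measure P B \<le> c P * measure Q B"
      by metis
    \<comment> \<open>The summand 1 keeps \<open>c'\<close> positive when \<open>F n k\<close> is
      empty, so that \<open>\<eta>\<close> is a proper quotient.\<close>
    define c' where "c' = 1 + (\<Sum>P\<in>F n k. c P)"
    have "(\<Sum>P\<in>F n k. c P) \<ge> 0" "\<And>P. P \<in> F n k \<Longrightarrow> c P \<le> (\<Sum>P\<in>F n k. c P)"
      using less_imp_le[OF c(1)] F(1) by (auto intro!: sum_nonneg member_le_sum)
    then have c': "c' > 0" "\<And>P. P \<in> F n k \<Longrightarrow> c P \<le> c'"
      unfolding c'_def by (simp, force)
    define \<eta> where "\<eta> = d n k / c'"
    have \<eta>: "\<eta> > 0" using F(3) c'(1) by (simp add: \<eta>_def)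
    have ac: "measure P B < \<delta>" if P: "P \<in> K n" and B: "B \<in> sets (borel_of X)" "measure Q B < \<eta>" for P B
    proof -
      have "measure R B < d n k" if R: "R \<in> F n k" for R
      proof -
        have "measure R B \<le> c' * measure Q B"
          using c(2)[OF R B(1)] mult_right_mono[OF c'(2)[OF R] measure_nonneg[of Q B]] by linarith
        also have "\<dots> < c' * \<eta>" using B(2) c'(1) by simp
        finally show ?thesis using c'(1) by (simp add: \<eta>_def)
      qed
      then show ?thesis using F(4)[OF B(1) _ P] k by fastforce
    qed
    show "\<exists>L>0. \<forall>\<alpha>\<in>\<A>. measure (Pis \<alpha>) {p \<in> prob_simplex \<alpha>. excess Q \<alpha> L p > \<delta>} < \<epsilon>"
    proof (intro exI[of _ "2/\<eta>"] conjI ballI)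
      show "2/\<eta> > 0" using \<eta> by simp
      fix \<alpha> assume \<alpha>: "\<alpha> \<in> \<A>"
      define G where "G = {p \<in> prob_simplex \<alpha>. excess Q \<alpha> (2/\<eta>) p > \<delta>}"
      have "openin (prob_simplex_top \<alpha>) {p \<in> topspace (prob_simplex_top \<alpha>). excess Q \<alpha> (2/\<eta>) p \<in> {\<delta><..}}"
        using borel_partitionD(1)[OF partition[OF \<alpha>]]
        by (intro openin_continuous_map_preimage[OF continuous_map_excess]) auto
      then have G: "G \<in> sets (borel_of (prob_simplex_top \<alpha>))" by (simp add: G_def borel_of_openin)
      have "excess Q \<alpha> (2/\<eta>) (proj \<alpha> P) \<le> \<delta>" if "P \<in> K n" for P
        using excess_proj_le[OF _ Q(1) partition[OF \<alpha>] \<delta> \<eta>] ac[OF that] that KM by blast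
      then have "cyl \<alpha> G \<subseteq> space M - K n"
        unfolding spM by (auto simp: cyl_def G_def not_less[symmetric])
      then have "measure M (cyl \<alpha> G) \<le> measure M (space M - K n)"
        using K(2) by (intro M.finite_measure_mono) auto
      also have "\<dots> < \<epsilon>" using M.prob_compl[OF K(2)[of n]] K(3)[of n] n by simp
      finally have "measure M (cyl \<alpha> G) < \<epsilon>" .
      then show "measure (Pis \<alpha>) {p \<in> prob_simplex \<alpha>. excess Q \<alpha> (2/\<eta>) p > \<delta>} < \<epsilon>"
        using measure_cyl[OF M(1) \<alpha> G] M(2)[OF \<alpha>] by (simp add: projects_to_def G_def)
    qed
  qed
qed

theorem mainTheorem6:
  fixes X :: "'a topology" and \<A> :: "'a set set set"
    and Pis :: "'a set set \<Rightarrow> ('a set \<Rightarrow> real) measure"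
  assumes "Hausdorff_space X"
    and "\<forall>\<alpha>\<in>\<A>. borel_partition X \<alpha>"
    and "directed_partitions \<A>"
    and "resolves X \<A>"
    and "minimal_conditions X \<A>"
    and "\<forall>\<alpha>\<in>\<A>. sets (Pis \<alpha>) = sets (borel_of (prob_simplex_top \<alpha>)) \<and> prob_space (Pis \<alpha>)"
    and "coherent \<A> Pis"
  shows "(\<exists>!Pim. radon_prob (weak_top X) Pim \<and> (\<forall>\<alpha>\<in>\<A>. projects_to Pim \<alpha> (Pis \<alpha>)))
     \<longleftrightarrow> (\<exists>Q\<in>M1 X. \<forall>\<epsilon>>0. \<forall>\<delta>>0. \<exists>L>0. \<forall>\<alpha>\<in>\<A>.
            measure (Pis \<alpha>) {p \<in> prob_simplex \<alpha>.
               (\<Sum>A\<in>\<alpha>. \<bar>p A - min (p A) (L * measure Q A)\<bar>) > \<delta>} < \<epsilon>)"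
    (is "?unique \<longleftrightarrow> ?dominated")
proof -
  interpret partition_system X \<A> Pis
  proof (rule partition_system.intro)
    show "Hausdorff_space (weak_top X)" using assms(5) by (simp only: minimal_conditions_def)
    show "borel_partition X \<alpha>" "sets (Pis \<alpha>) = sets (borel_of (prob_simplex_top \<alpha>))"
      "prob_space (Pis \<alpha>)" if "\<alpha> \<in> \<A>" for \<alpha>
      using assms(2,6) that by blast+
  qed (fact assms)+
  have dominated: "?dominated \<longleftrightarrow> (\<exists>Q\<in>M1 X. \<forall>\<epsilon>>0. \<forall>\<delta>>0. \<exists>L>0. \<forall>\<alpha>\<in>\<A>.
    measure (Pis \<alpha>) {p \<in> prob_simplex \<alpha>. excess Q \<alpha> L p > \<delta>} < \<epsilon>)"
    unfolding excess_def ..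
  show ?thesis
    unfolding dominated
  proof
    assume ?unique
    then show "\<exists>Q\<in>M1 X. \<forall>\<epsilon>>0. \<forall>\<delta>>0. \<exists>L>0. \<forall>\<alpha>\<in>\<A>.
        measure (Pis \<alpha>) {p \<in> prob_simplex \<alpha>. excess Q \<alpha> L p > \<delta>} < \<epsilon>"
      using projecting_imp_domination by blast
  next
    assume "\<exists>Q\<in>M1 X. \<forall>\<epsilon>>0. \<forall>\<delta>>0. \<exists>L>0. \<forall>\<alpha>\<in>\<A>.
      measure (Pis \<alpha>) {p \<in> prob_simplex \<alpha>. excess Q \<alpha> L p > \<delta>} < \<epsilon>"
    then obtain Q where Q: "Q \<in> M1 X" "\<forall>\<epsilon>>0. \<forall>\<delta>>0. \<exists>L>0. \<forall>\<alpha>\<in>\<A>.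
      measure (Pis \<alpha>) {p \<in> prob_simplex \<alpha>. excess Q \<alpha> L p > \<delta>} < \<epsilon>" by blast
    show ?unique
    \<comment> \<open>For \<open>\<A> = {}\<close> the bounds and the projection property are
      vacuous; what remains of the condition is that \<open>M1 X\<close> has a member.\<close>
    proof (cases "\<A> = {}")
      case True
      then show ?thesis using radon_prob_ex1_if_no_partitions[OF True Q(1)] by simp
    next
      case False
      obtain M where "radon_prob (weak_top X) M" "\<forall>\<alpha>\<in>\<A>. projects_to M \<alpha> (Pis \<alpha>)"
        using projecting_exists[OF False dominated_set_tight[OF Q]] by blast
      then show ?thesis using projecting_unique[OF False] by (intro ex1I[of _ M]) auto
    qed
  qed
qed

end
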